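(* Let $(\mathcal{X}_t)_{t\ge 1}$, $(\mathcal{D}_t)_{t\ge 1}$, $f_t$, $\hat f_t$, $f$ be as described in the context, where $(\mathcal{D}_t)_{t\ge 1}$ is an output of the online CP-dictionary learning algorithm run on $(\mathcal{X}_t)_{t\ge1}$. Assume the following. (A1) $\mathcal{X}_t=\varphi(Y_t)$, where $(Y_t)$ is an irreducible and aperiodic Markov chain on a finite state space $\Omega$ with transition matrix $P$ and unique stationary distribution $\pi$, and $\varphi:\Omega\to\mathbb{R}^{I_1\times\dots\times I_n\times b}$ is a bounded function. (A2) For each $1\le i\le n$, $\mathcal{C}^{(i)}\subseteq\mathbb{R}^{I_i\times R}$ is compact, convex and contains at least two points; $\mathcal{C}^{\mathrm{code}}\subseteq\mathbb{R}^{R\times b}$ is compact and convex. (A3) The non-increasing weights $w_t\in(0,1]$ satisfy $\sum_{t=1}^\infty w_t=\infty$ and $\sum_{t=1}^\infty w_t^2\sqrt{t}<\infty$, and $w_{t+1}^{-1}-w_t^{-1}\le 1$ for all sufficiently large $t$. Then the following hold. (i) $\lim_{t\to\infty}\mathbb{E}[f_t(\mathcal{D}_t)]=\lim_{t\to\infty}\mathbb{E}[\hat f_t(\mathcal{D}_t)]<\infty$. (ii) $f_t(\mathcal{D}_t)-\hat f_t(\mathcal{D}_t)\to 0$ and $f(\mathcal{D}_t)-\hat f_t(\mathcal{D}_t)\to 0$ as $t\to\infty$ almost surely. (iii) Assume further (A4): the expected loss function $f$ is continuously differentiable and has Lipschitz gradient. Then the distance (measured by block-wise Frobenius distance) between $\mathcal{D}_t$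 and the set of all stationary points of $f$ in $\mathcal{C}^{\mathrm{dict}}$ converges to zero almost surely.
   Context: Setting. Fix integers $n,b,R,I_1,\dots,I_n\ge 1$, constants $\lambda\ge 0$ and $c'>0$, a non-increasing sequence of weights $w_t\in(0,1]$ ($t\ge 1$), and sets $\mathcal{C}^{(i)}\subseteq\mathbb{R}^{I_i\times R}$ ($1\le i\le n$) and $\mathcal{C}^{\mathrm{code}}\subseteq\mathbb{R}^{R\times b}$. Put $\mathcal{C}^{\mathrm{dict}}=\mathcal{C}^{(1)}\times\dots\times\mathcal{C}^{(n)}$. $\|\cdot\|_F$ is the Euclidean norm of the entries of a tensor (or of a tuple of matrices), $\|\cdot\|_1$ is the sum of absolute values of entries. For tuples $\mathcal{D}=[U^{(1)},\dots,U^{(n)}]$ and $\mathcal{E}=[V^{(1)},\dots,V^{(n)}]$ in $\prod_i\mathbb{R}^{I_i\times R}$, write $\mathrm{tr}(\mathcal{D}^T\mathcal{E})=\sum_i \mathrm{tr}((U^{(i)})^TV^{(i)})$. Losses. For $\mathcal{D}=[U^{(1)},\dots,U^{(n)}]$, $\mathrm{Out}(\mathcal{D})\in\mathbb{R}^{I_1\times\dots\times I_n\times R}$ is the tensor whose $r$-th slice along the last mode is the outer product $U^{(1)}(:,r)\otimes\dots\otimes U^{(n)}(:,r)$. For $H\in\mathbb{R}^{R\times b}$, $\mathrm{Out}(\mathcal{D})\times_{n+1}H\in\mathbb{R}^{I_1\times\dots\times I_n\times b}$ is the tensor whose $j$-th slice along the last mode is $\sum_{r=1}^R H(r,j)\,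 U^{(1)}(:,r)\otimes\dots\otimes U^{(n)}(:,r)$. For $\mathcal{X}\in\mathbb{R}^{I_1\times\dots\times I_n\times b}$ set $$\ell(\mathcal{X},\mathcal{D},H)=\|\mathcal{X}-\mathrm{Out}(\mathcal{D})\times_{n+1}H\|_F^2+\lambda\|H\|_1,\qquad \ell(\mathcal{X},\mathcal{D})=\inf_{H\in\mathcal{C}^{\mathrm{code}}}\ell(\mathcal{X},\mathcal{D},H).$$ Empirical loss: $f_0\equiv 0$, $f_t(\mathcal{D})=(1-w_t)f_{t-1}(\mathcal{D})+w_t\,\ell(\mathcal{X}_t,\mathcal{D})$. Expected loss: $f(\mathcal{D})=\mathbb{E}_{\mathcal{X}\sim\pi}[\ell(\mathcal{X},\mathcal{D})]$, where $\mathcal{X}\sim\pi$ means $\mathcal{X}=\varphi(Y)$ with $Y$ distributed according to the stationary distribution $\pi$. Algorithm (online CP-dictionary learning). Start from $\mathcal{D}_0=[U_0^{(1)},\dots,U_0^{(n)}]\in\mathcal{C}^{\mathrm{dict}}$ and $\hat f_0\equiv 0$. For $t=1,2,\dots$: choose $H_t\in\arg\min_{H\in\mathcal{C}^{\mathrm{code}}}\ell(\mathcal{X}_t,\mathcal{D}_{t-1},H)$; define the surrogate loss $\hat f_t(\mathcal{D})=(1-w_t)\hat f_{t-1}(\mathcal{D})+w_t\,\ell(\mathcal{X}_t,\mathcal{D},H_t)$; then for $i=1,\dots,n$ successively, with $\mathcal{C}_t^{(i)}=\{U\in\mathcal{C}^{(i)}:\|U-U_{t-1}^{(i)}\|_F\le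 c'w_t\}$, choose $$U_t^{(i)}\in\arg\min_{U\in\mathcal{C}_t^{(i)}}\hat f_t(U_t^{(1)},\dots,U_t^{(i-1)},U,U_{t-1}^{(i+1)},\dots,U_{t-1}^{(n)}).$$ Set $\mathcal{D}_t=[U_t^{(1)},\dots,U_t^{(n)}]$. Any sequence $(\mathcal{D}_t)_{t\ge 1}$ so produced is called an output of the algorithm. A point $\mathcal{D}\in\mathcal{C}^{\mathrm{dict}}$ is a stationary point of a differentiable function $g$ over (or in) $\mathcal{C}^{\mathrm{dict}}$ if $\mathrm{tr}(\nabla g(\mathcal{D})^T(\mathcal{D}'-\mathcal{D}))\ge 0$ for all $\mathcal{D}'\in\mathcal{C}^{\mathrm{dict}}$ (equivalently, $-\nabla g(\mathcal{D})$ lies in the normal cone of $\mathcal{C}^{\mathrm{dict}}$ at $\mathcal{D}$). *)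

theory Defs
  imports "HOL-Probability.Probability"
begin

text \<open>
  Encoding of the dimensions.  The modes \<open>1, \<dots>, n\<close> are the elements of a finite linearly ordered
  type \<open>'n\<close> (the algorithm runs through the blocks in this order), the rank indices \<open>1, \<dots>, R\<close> and
  the batch indices \<open>1, \<dots>, b\<close> are finite types \<open>'r\<close> and \<open>'b\<close>.
  The \<open>n\<close> row dimensions may differ, so the row indices of all modes are taken from one finite
  type \<open>'k\<close>, and mode \<open>i\<close> uses the nonempty subset \<open>I i\<close> of it, with \<open>I\<^sub>i = card (I i)\<close>.  An
  \<open>I\<^sub>i \<times> R\<close> matrix is a \<open>real^'r^'k\<close> whose rows outside \<open>I i\<close> vanish, and a tensor in
  \<open>\<real>\<^bsup>I\<^sub>1 \<times> \<dots> \<times> I\<^sub>n \<times> b\<^esup>\<close> is a \<open>real^'b^('n \<Rightarrow> 'k)\<close> that vanishes at every multi-index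
  \<open>\<kappa>\<close> with some \<open>\<kappa> i \<notin> I i\<close>.

  With this encoding \<open>norm\<close> is the Frobenius norm of matrices, tensors and tuples of matrices,
  and for tuples \<open>D \<bullet> E\<close> is \<open>tr(D\<^sup>T E) = (\<Sum>i. tr((D $ i)\<^sup>T (E $ i)))\<close>.
\<close>

type_synonym ('n, 'k, 'r) mat_tuple = "real^'r^'k^'n"
type_synonym ('n, 'k, 'b) tensor = "real^'b^('n \<Rightarrow> 'k)"

definition matrices_on :: "'k set \<Rightarrow> (real^'r::finite^'k::finite) set" where
  "matrices_on K = {U. \<forall>k. k \<notin> K \<longrightarrow> U $ k = 0}"

definition tensors_on :: "('n \<Rightarrow> 'k set) \<Rightarrow> ('n::finite, 'k::finite, 'b::finite) tensor set" where
  "tensors_on I = {X. \<forall>\<kappa>. (\<exists>i. \<kappa> i \<notin> I i) \<longrightarrow> X $ \<kappa> = 0}"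

definition l1_norm :: "real^'b::finite^'r::finite \<Rightarrow> real" where
  "l1_norm H = (\<Sum>r\<in>UNIV. \<Sum>j\<in>UNIV. \<bar>H $ r $ j\<bar>)"

text \<open>
  Entries outside \<open>\<Prod>i. I i\<close> are set to zero for every argument, so all losses below ignore the
  padding coordinates of a tuple and their gradients vanish there: differentiating in the ambient
  type amounts to differentiating on \<open>\<Prod>i. \<real>\<^bsup>I\<^sub>i \<times> R\<^esup>\<close>.
\<close>

definition Out ::
  "('n \<Rightarrow> 'k set) \<Rightarrow> ('n::finite, 'k::finite, 'r::finite) mat_tuple \<Rightarrow> ('n, 'k, 'r) tensor" where
  "Out I D = (\<chi> \<kappa> r. if \<forall>i. \<kappa> i \<in> I i then \<Prod>i\<in>UNIV. D $ i $ \<kappa> i $ r else 0)"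

definition mode_product ::
  "('n::finite, 'k::finite, 'r::finite) tensor \<Rightarrow> real^'b::finite^'r \<Rightarrow> ('n, 'k, 'b) tensor"
  (infixl "\<times>\<^sub>m" 70) where
  "T \<times>\<^sub>m H = (\<chi> \<kappa> j. \<Sum>r\<in>UNIV. H $ r $ j * T $ \<kappa> $ r)"

definition code_loss ::
  "real \<Rightarrow> ('n \<Rightarrow> 'k set) \<Rightarrow> ('n::finite, 'k::finite, 'b::finite) tensor
    \<Rightarrow> ('n, 'k, 'r::finite) mat_tuple \<Rightarrow> real^'b^'r \<Rightarrow> real" where
  "code_loss lam I X D H = (norm (X - Out I D \<times>\<^sub>m H))\<^sup>2 + lam * l1_norm H"

definition loss ::
  "real \<Rightarrow> ('n \<Rightarrow> 'k set) \<Rightarrow> (real^'b^'r) set \<Rightarrow> ('n::finite, 'k::finite, 'b::finite) tensor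
    \<Rightarrow> ('n, 'k, 'r::finite) mat_tuple \<Rightarrow> real" where
  "loss lam I Ccode X D = (INF H\<in>Ccode. code_loss lam I X D H)"

primrec emp_loss ::
  "real \<Rightarrow> ('n \<Rightarrow> 'k set) \<Rightarrow> (real^'b^'r) set \<Rightarrow> (nat \<Rightarrow> real)
    \<Rightarrow> (nat \<Rightarrow> ('n::finite, 'k::finite, 'b::finite) tensor)
    \<Rightarrow> nat \<Rightarrow> ('n, 'k, 'r::finite) mat_tuple \<Rightarrow> real" where
  "emp_loss lam I Ccode w X 0 D = 0"
| "emp_loss lam I Ccode w X (Suc t) D =
     (1 - w (Suc t)) * emp_loss lam I Ccode w X t D + w (Suc t) * loss lam I Ccode (X (Suc t)) D"

primrec sur_loss ::
  "real \<Rightarrow> ('n \<Rightarrow> 'k set) \<Rightarrow> (nat \<Rightarrow> real)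
    \<Rightarrow> (nat \<Rightarrow> ('n::finite, 'k::finite, 'b::finite) tensor) \<Rightarrow> (nat \<Rightarrow> real^'b^'r)
    \<Rightarrow> nat \<Rightarrow> ('n, 'k, 'r::finite) mat_tuple \<Rightarrow> real" where
  "sur_loss lam I w X H 0 D = 0"
| "sur_loss lam I w X H (Suc t) D =
     (1 - w (Suc t)) * sur_loss lam I w X H t D
       + w (Suc t) * code_loss lam I (X (Suc t)) D (H (Suc t))"

definition exp_loss ::
  "real \<Rightarrow> ('n \<Rightarrow> 'k set) \<Rightarrow> (real^'b^'r) set \<Rightarrow> 's pmf
    \<Rightarrow> ('s \<Rightarrow> ('n::finite, 'k::finite, 'b::finite) tensor)
    \<Rightarrow> ('n, 'k, 'r::finite) mat_tuple \<Rightarrow> real" where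
  "exp_loss lam I Ccode \<pi> \<phi> D = measure_pmf.expectation \<pi> (\<lambda>y. loss lam I Ccode (\<phi> y) D)"

definition dict_set ::
  "('n \<Rightarrow> (real^'r^'k) set) \<Rightarrow> ('n::finite, 'k::finite, 'r::finite) mat_tuple set" where
  "dict_set C = {D. \<forall>i. D $ i \<in> C i}"

text \<open>
  \<open>(D t)\<close> is an output of the online algorithm on the data \<open>(X t)\<close>, with codes \<open>(H t)\<close>; step
  \<open>Suc t\<close> produces \<open>H (Suc t)\<close> and \<open>D (Suc t)\<close> from \<open>D t\<close>.  The values \<open>w 0\<close>, \<open>X 0\<close> and \<open>H 0\<close>
  are not used.
\<close>

definition ocpdl_output ::
  "real \<Rightarrow> ('n \<Rightarrow> 'k set) \<Rightarrow> ('n \<Rightarrow> (real^'r^'k) set) \<Rightarrow> (real^'b^'r) set \<Rightarrow> (nat \<Rightarrow> real) \<Rightarrow> real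
    \<Rightarrow> (nat \<Rightarrow> ('n::{finite,linorder}, 'k::finite, 'b::finite) tensor) \<Rightarrow> (nat \<Rightarrow> real^'b^'r)
    \<Rightarrow> (nat \<Rightarrow> ('n, 'k, 'r::finite) mat_tuple) \<Rightarrow> bool" where
  "ocpdl_output lam I C Ccode w c X H D \<longleftrightarrow>
     D 0 \<in> dict_set C \<and>
     (\<forall>t. is_arg_min (code_loss lam I (X (Suc t)) (D t)) (\<lambda>V. V \<in> Ccode) (H (Suc t)) \<and>
          (\<forall>i. is_arg_min
             (\<lambda>U. sur_loss lam I w X H (Suc t)
                (\<chi> j. if j < i then D (Suc t) $ j else if j = i then U else D t $ j))
             (\<lambda>U. U \<in> C i \<and> norm (U - D t $ i) \<le> c * w (Suc t))
             (D (Suc t) $ i)))"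

definition transition_matrix :: "real^'s::finite^'s \<Rightarrow> bool" where
  "transition_matrix P \<longleftrightarrow> (\<forall>x y. 0 \<le> P $ x $ y) \<and> (\<forall>x. (\<Sum>y\<in>UNIV. P $ x $ y) = 1)"

primrec mat_power :: "real^'s::finite^'s \<Rightarrow> nat \<Rightarrow> real^'s^'s" where
  "mat_power P 0 = mat 1"
| "mat_power P (Suc k) = mat_power P k ** P"

definition irreducible_matrix :: "real^'s::finite^'s \<Rightarrow> bool" where
  "irreducible_matrix P \<longleftrightarrow> (\<forall>x y. \<exists>k. mat_power P k $ x $ y > 0)"

definition aperiodic_matrix :: "real^'s::finite^'s \<Rightarrow> bool" where
  "aperiodic_matrix P \<longleftrightarrow> (\<forall>x. Gcd {k. k \<ge> 1 \<and> mat_power P k $ x $ x > 0} = 1)"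

definition stationary_distribution :: "real^'s::finite^'s \<Rightarrow> 's pmf \<Rightarrow> bool" where
  "stationary_distribution P \<rho> \<longleftrightarrow> (\<forall>y. (\<Sum>x\<in>UNIV. pmf \<rho> x * P $ x $ y) = pmf \<rho> y)"

text \<open>
  The chain is indexed by \<open>t \<ge> 1\<close> and its initial distribution is arbitrary.  The equation is
  \<open>Pr(Y\<^bsub>t+1\<^esub> = y\<^bsub>t+1\<^esub> | Y\<^sub>1 = y\<^sub>1, \<dots>, Y\<^sub>t = y\<^sub>t) = P(y\<^sub>t, y\<^bsub>t+1\<^esub>)\<close>, multiplied out so that paths of
  probability zero need no exception.
\<close>

definition markov_chain ::
  "'w measure \<Rightarrow> real^'s::finite^'s \<Rightarrow> (nat \<Rightarrow> 'w \<Rightarrow> 's) \<Rightarrow> bool" where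
  "markov_chain M P Y \<longleftrightarrow>
     transition_matrix P \<and>
     (\<forall>t\<ge>1. Y t \<in> measurable M (count_space UNIV)) \<and>
     (\<forall>t\<ge>1. \<forall>y. measure M {x \<in> space M. \<forall>s\<in>{1..Suc t}. Y s x = y s} =
        measure M {x \<in> space M. \<forall>s\<in>{1..t}. Y s x = y s} * P $ y t $ y (Suc t))"

text \<open>
  The gradient is that of a function on the whole ambient space.  Differentiability, continuity
  and the Lipschitz bound are only required at points of \<open>S\<close>: a polynomial loss does not have a
  globally Lipschitz gradient.  Since \<open>GDERIV\<close> is the full derivative, the gradient is unique also at
  boundary points of \<open>S\<close>.
\<close>

definition C1_Lipschitz_gradient_on :: "('a::real_inner \<Rightarrow> real) \<Rightarrow> 'a set \<Rightarrow> bool" where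
  "C1_Lipschitz_gradient_on g S \<longleftrightarrow>
     (\<exists>G L. (\<forall>x\<in>S. GDERIV g x :> G x) \<and> continuous_on S G \<and> L-lipschitz_on S G)"

definition stationary_point :: "('a::real_inner \<Rightarrow> real) \<Rightarrow> 'a set \<Rightarrow> 'a \<Rightarrow> bool" where
  "stationary_point g S x \<longleftrightarrow>
     x \<in> S \<and> (\<exists>G. GDERIV g x :> G \<and> (\<forall>x'\<in>S. G \<bullet> (x' - x) \<ge> 0))"

definition block_dist ::
  "('n::finite, 'k::finite, 'r::finite) mat_tuple \<Rightarrow> ('n, 'k, 'r) mat_tuple \<Rightarrow> real" where
  "block_dist D E = (\<Sum>i\<in>UNIV. norm (D $ i - E $ i))"

text \<open>In \<open>ereal\<close> the distance to the empty set is \<open>\<infinity>\<close> (it would be \<open>0\<close> for \<open>infdist\<close>).\<close>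

definition block_setdist ::
  "('n::finite, 'k::finite, 'r::finite) mat_tuple \<Rightarrow> ('n, 'k, 'r) mat_tuple set \<Rightarrow> ereal" where
  "block_setdist D S = (INF E\<in>S. ereal (block_dist D E))"

end

theory Submission
  imports Defs
begin

text \<open>
  Since the state space is finite, the empirical loss differs from the expected loss only through
  the errors \<open>q\<^sub>t(s)\<close>, the averaging weight of the visits to \<open>s\<close> up to time \<open>t\<close> minus \<open>\<pi>(s)\<close>.
  The Poisson equation splits \<open>\<Sum>u\<le>t. 1(Y\<^sub>u = s) - \<pi>(s)\<close> into a martingale with bounded increments
  and a bounded remainder, so its mean absolute value is \<open>O(\<surd>t)\<close>; together with the weight
  conditions this gives \<open>(\<Sum>t. w\<^bsub>t+1\<^esub> \<bar>q\<^sub>t(s)\<bar>) < \<infinity>\<close> almost surely.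

  On such a path let \<open>r\<^sub>t = f\<^sub>t - f\<close>.  Comparing each block update with a short Frank--Wolfe step shows
  that the surrogate value at \<open>D\<^sub>t\<close> minus \<open>r\<^sub>t(D\<^sub>t)\<close> decreases, up to a summable error, by at least a
  multiple of \<open>w\<^bsub>t+1\<^esub>\<close> times both the gap between surrogate and empirical loss and the Frank--Wolfe gap
  of the surrogate.  Both gaps are thus summable against the weights and change by \<open>O(w\<^bsub>t+1\<^esub>)\<close>, hence
  tend to zero.  At a limit point the surrogates touch \<open>f\<close> from above, so the vanishing Frank--Wolfe gap
  carries over to the gradient of \<open>f\<close>.  Expectations converge by dominated convergence.
\<close>

section \<open>Sequences and suprema\<close>

text \<open>The increments of \<open>b\<^sup>2\<close> are at most
  \<open>2 * K * (a n * b n) + K\<^sup>2 * (a n)\<^sup>2\<close>, which is summable, so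
  \<open>b\<^sup>2\<close> converges. A positive limit would keep \<open>b\<close> away from zero
  and make \<open>a\<close> itself summable by comparison with \<open>a n * b n\<close>.\<close>

lemma tendsto_0_of_summable_mult:
  fixes a b :: "nat \<Rightarrow> real"
  assumes a: "\<And>n. 0 \<le> a n" and b: "\<And>n. 0 \<le> b n"
    and ab: "summable (\<lambda>n. a n * b n)" and a2: "summable (\<lambda>n. (a n)\<^sup>2)"
    and diverges: "\<not> summable a"
    and slow: "\<And>n. \<bar>b (Suc n) - b n\<bar> \<le> K * a n"
  shows "b \<longlonglongrightarrow> 0"
proof -
  have "\<bar>(b (Suc n))\<^sup>2 - (b n)\<^sup>2\<bar> \<le> 2 * K * (a n * b n) + K\<^sup>2 * (a n)\<^sup>2" for n
  proof -
    have "\<bar>(b (Suc n))\<^sup>2 - (b n)\<^sup>2\<bar> = \<bar>b (Suc n) - b n\<bar> * (b (Suc n) + b n)"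
      using b[of n] b[of "Suc n"] by (simp add: power2_eq_square square_diff_square_factored abs_mult mult.commute)
    also have "\<dots> \<le> (K * a n) * (2 * b n + K * a n)"
      using slow[of n] b[of n] b[of "Suc n"] by (intro mult_mono) auto
    finally show ?thesis by (simp add: algebra_simps power2_eq_square)
  qed
  then have "summable (\<lambda>n. (b (Suc n))\<^sup>2 - (b n)\<^sup>2)"
    by (intro summable_comparison_test'[OF summable_add[OF summable_mult[OF ab] summable_mult[OF a2]]])
      auto
  then have "convergent (\<lambda>n. \<Sum>i<n. (b (Suc i))\<^sup>2 - (b i)\<^sup>2)"
    by (simp add: summable_iff_convergent)
  moreover have "(\<Sum>i<n. (b (Suc i))\<^sup>2 - (b i)\<^sup>2) = (b n)\<^sup>2 - (b 0)\<^sup>2" for n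
    by (rule sum_lessThan_telescope)
  ultimately have "convergent (\<lambda>n. (b n)\<^sup>2 - (b 0)\<^sup>2)"
    by simp
  then have "convergent (\<lambda>n. (b n)\<^sup>2)"
    by (simp only: convergent_diff_const_right_iff)
  then obtain l where l: "(\<lambda>n. (b n)\<^sup>2) \<longlonglongrightarrow> l" by (auto simp: convergent_def)
  have "l = 0"
  proof (rule ccontr)
    assume "l \<noteq> 0"
    moreover have "0 \<le> l" using l by (rule LIMSEQ_le_const) auto
    ultimately have "l > 0" by simp
    then have "\<forall>\<^sub>F n in sequentially. (b n)\<^sup>2 > l / 2"
      by (intro order_tendstoD(1)[OF l]) auto
    then have "\<forall>\<^sub>F n in sequentially. norm (a n) \<le> a n * b n / sqrt (l / 2)"
    proof eventually_elim
      case (elim n)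
      then have "sqrt (l / 2) \<le> b n" using b[of n] by (simp add: real_le_lsqrt)
      then have "a n * sqrt (l/2) \<le> a n * b n" using a by (simp add: mult_left_mono)
      then show ?case using \<open>l > 0\<close> a[of n] by (simp add: field_simps)
    qed
    then have "summable a"
      using ab summable_comparison_test_ev[of a "\<lambda>n. a n * b n / sqrt (l / 2)"] summable_divide by blast
    with diverges show False by simp
  qed
  with l have "(\<lambda>n. sqrt ((b n)\<^sup>2)) \<longlonglongrightarrow> sqrt 0" by (intro tendsto_real_sqrt) simp
  then show ?thesis using b by simp
qed

text \<open>Telescoping: the partial sums from \<open>m\<close> on are bounded by the total drop of
  \<open>v\<close> plus the bounded sums of \<open>c\<close>. The threshold \<open>m\<close>
  accommodates weight conditions that hold only eventually.\<close>

lemma summable_of_le_diff: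
  fixes v x c :: "nat \<Rightarrow> real"
  assumes x: "\<And>n. 0 \<le> x n" and step: "\<And>n. n \<ge> m \<Longrightarrow> x n \<le> v n - v (Suc n) + c n"
    and c: "summable c" and v: "\<And>n. l \<le> v n"
  shows "summable x"
proof -
  have cm: "summable (\<lambda>n. c (n + m))" using c by (simp add: summable_iff_shift)
  then have "Bseq (\<lambda>n. \<Sum>k\<le>n. c (k + m))"
    by (intro convergent_imp_Bseq) (simp only: summable_iff_convergent')
  then obtain K where K: "\<And>n. \<bar>\<Sum>k\<le>n. c (k + m)\<bar> \<le> K" by (auto simp: Bseq_def)
  have "summable (\<lambda>n. x (n + m))"
  proof (rule bounded_imp_summable)
    show "0 \<le> x (n + m)" for n by (rule x)
    show "(\<Sum>k\<le>n. x (k + m)) \<le> v m - l + K" for n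
    proof -
      have "(\<Sum>k\<le>n. x (k + m)) \<le> (\<Sum>k\<le>n. v (k + m) - v (Suc k + m) + c (k + m))"
        using step by (intro sum_mono) auto
      also have "\<dots> = (\<Sum>k\<le>n. v (k + m) - v (Suc k + m)) + (\<Sum>k\<le>n. c (k + m))"
        by (rule sum.distrib)
      also have "(\<Sum>k\<le>n. v (k + m) - v (Suc k + m)) = v m - v (Suc n + m)"
        using sum_telescope[of "\<lambda>k. v (k + m)" n] by simp
      finally show ?thesis using K[of n] v[of "Suc n + m"] by linarith
    qed
  qed
  then show ?thesis by (simp add: summable_iff_shift)
qed

text \<open>Subtracting the partial sums of \<open>c\<close> turns \<open>v\<close> into a
  decreasing sequence that is bounded below.\<close>

lemma convergent_of_le_add_summable:
  fixes v c :: "nat \<Rightarrow> real"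
  assumes step: "\<And>n. v (Suc n) \<le> v n + c n" and c: "summable c" and v: "\<And>n. l \<le> v n"
  shows "convergent v"
proof -
  define u where "u n = v n - (\<Sum>k<n. c k)" for n
  have cc: "convergent (\<lambda>n. \<Sum>k<n. c k)" using c by (simp add: summable_iff_convergent)
  then obtain K where K: "\<And>n. \<bar>\<Sum>k<n. c k\<bar> \<le> K"
    using convergent_imp_Bseq[OF cc] by (auto simp: Bseq_def)
  have "decseq u" using step by (auto simp: decseq_Suc_iff u_def algebra_simps)
  moreover have "l - K \<le> u n" for n using v[of n] K[of n] unfolding u_def by linarith
  ultimately have "convergent u" using decseq_convergent by (metis convergentI)
  then have "convergent (\<lambda>n. u n + (\<Sum>k<n. c k))" using cc by (rule convergent_add)
  then show ?thesis by (simp add: u_def)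
qed

lemma abs_SUP_diff_le:
  fixes f g :: "'a \<Rightarrow> real"
  assumes "A \<noteq> {}" "bdd_above (f ` A)" "bdd_above (g ` A)" and le: "\<And>x. x \<in> A \<Longrightarrow> \<bar>f x - g x\<bar> \<le> C"
  shows "\<bar>(SUP x\<in>A. f x) - (SUP x\<in>A. g x)\<bar> \<le> C"
proof -
  have "(SUP x\<in>A. f x) \<le> (SUP x\<in>A. g x) + C"
  proof (rule cSUP_least[OF assms(1)])
    fix x assume x: "x \<in> A"
    show "f x \<le> (SUP x\<in>A. g x) + C" using le[OF x] cSUP_upper[OF x assms(3)] by linarith
  qed
  moreover have "(SUP x\<in>A. g x) \<le> (SUP x\<in>A. f x) + C"
  proof (rule cSUP_least[OF assms(1)])
    fix x assume x: "x \<in> A"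
    show "g x \<le> (SUP x\<in>A. f x) + C" using le[OF x] cSUP_upper[OF x assms(2)] by linarith
  qed
  ultimately show ?thesis by linarith
qed

text \<open>The index is shifted against the algorithm: step \<open>Suc t\<close> uses the weight \<open>w t\<close> and the state
  \<open>y t\<close>.  The empty average at \<open>t = 0\<close> has total mass \<open>0\<close>, hence the initial error \<open>- p s\<close>.\<close>

primrec occupation_error :: "(nat \<Rightarrow> real) \<Rightarrow> ('s \<Rightarrow> real) \<Rightarrow> (nat \<Rightarrow> 's) \<Rightarrow> nat \<Rightarrow> 's \<Rightarrow> real" where
  "occupation_error w p y 0 s = - p s"
| "occupation_error w p y (Suc t) s =
     (1 - w t) * occupation_error w p y t s + w t * (of_bool (y t = s) - p s)"

lemma occupation_error_bound:
  assumes w: "\<And>t. 0 \<le> w t \<and> w t \<le> 1" and p: "0 \<le> p s" "p s \<le> 1"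
  shows "\<bar>occupation_error w p y t s\<bar> \<le> 1"
proof (induction t)
  case 0
  then show ?case using p by simp
next
  case (Suc t)
  have "\<bar>(1 - w t) * occupation_error w p y t s\<bar> \<le> (1 - w t) * 1"
    unfolding abs_mult using Suc w[of t] by (intro mult_mono) auto
  moreover have "\<bar>w t * (of_bool (y t = s) - p s)\<bar> \<le> w t * 1"
    unfolding abs_mult using p w[of t] by (intro mult_mono) auto
  ultimately have "\<bar>(1 - w t) * occupation_error w p y t s + w t * (of_bool (y t = s) - p s)\<bar>
      \<le> (1 - w t) * 1 + w t * 1"
    by (rule order_trans[OF abs_triangle_ineq add_mono])
  then show ?case by simp
qed

lemma occupation_error_diff:
  assumes w: "\<And>t. 0 \<le> w t \<and> w t \<le> 1" and p: "0 \<le> p s" "p s \<le> 1"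
  shows "\<bar>occupation_error w p y (Suc t) s - occupation_error w p y t s\<bar> \<le> 2 * w t"
proof -
  have "occupation_error w p y (Suc t) s - occupation_error w p y t s
      = w t * (of_bool (y t = s) - p s - occupation_error w p y t s)"
    by (simp add: algebra_simps)
  moreover have "\<bar>of_bool (y t = s) - p s - occupation_error w p y t s\<bar> \<le> 2"
    using occupation_error_bound[of w p s y t] assms by (cases "y t = s") (auto simp: abs_le_iff)
  ultimately show ?thesis using w[of t] by (simp add: abs_mult mult.commute mult_left_mono)
qed

section \<open>Uniformly smooth families of functions\<close>

text \<open>One constant controls the value, the gradient and the Lipschitz constant of the
  gradient. Convex combinations then keep the same \<open>B\<close>, so the surrogates, which are
  averages of code losses, never lose smoothness.\<close>

definition smooth_bound :: "'a::real_inner set \<Rightarrow> real \<Rightarrow> ('a \<Rightarrow> real) \<Rightarrow> ('a \<Rightarrow> 'a) \<Rightarrow> bool" where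
  "smooth_bound S B k g \<longleftrightarrow> (\<forall>x\<in>S. \<bar>k x\<bar> \<le> B \<and> GDERIV k x :> g x \<and> norm (g x) \<le> B \<and>
     (\<forall>y\<in>S. norm (g x - g y) \<le> B * norm (x - y)))"

lemma smooth_boundD:
  assumes "smooth_bound S B k g" "x \<in> S"
  shows "\<bar>k x\<bar> \<le> B" "GDERIV k x :> g x" "norm (g x) \<le> B"
    "y \<in> S \<Longrightarrow> norm (g x - g y) \<le> B * norm (x - y)"
  using assms by (auto simp: smooth_bound_def)

text \<open>The one-dimensional mean value theorem on the segment from \<open>x\<close> to
  \<open>y\<close>. The bound on \<open>norm (z - x)\<close> is what the descent inequality
  needs.\<close>

lemma smooth_bound_mvt:
  assumes k: "smooth_bound S B k g" and S: "convex S" "x \<in> S" "y \<in> S"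
  obtains z where "z \<in> S" "norm (z - x) \<le> norm (y - x)" "k y - k x = g z \<bullet> (y - x)"
proof -
  define p where "p s = x + s *\<^sub>R (y - x)" for s :: real
  have p: "p s \<in> S" if "0 \<le> s" "s \<le> 1" for s
    using convexD_alt[OF S(1,2,3), of s] that by (simp add: p_def algebra_simps)
  have "((\<lambda>s. k (p s)) has_derivative (\<lambda>h. h * (g (p s) \<bullet> (y - x)))) (at s within {0..1})"
    if "0 \<le> s" "s \<le> 1" for s
  proof -
    have "(p has_derivative (\<lambda>h. h *\<^sub>R (y - x))) (at s within {0..1})"
      unfolding p_def by (auto intro!: derivative_eq_intros)
    moreover have "(k has_derivative (\<lambda>h. h \<bullet> g (p s))) (at (p s))"
      using smooth_boundD(2)[OF k p[OF that]] by (simp add: gderiv_def)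
    ultimately show ?thesis
      by (auto dest: has_derivative_compose simp: inner_commute)
  qed
  from mvt_simple[OF zero_less_one this] obtain s where
    "s \<in> {0<..<1}" "k (p 1) - k (p 0) = (1 - 0) * (g (p s) \<bullet> (y - x))" by auto
  moreover from this have "norm (p s - x) \<le> norm (y - x)"
    by (simp add: p_def mult_left_le_one_le)
  ultimately show ?thesis using that[of "p s"] p[of s] by (simp add: p_def)
qed

lemma smooth_bound_lipschitz:
  assumes k: "smooth_bound S B k g" and S: "convex S" "x \<in> S" "y \<in> S"
  shows "\<bar>k x - k y\<bar> \<le> B * norm (x - y)"
proof -
  obtain z where z: "z \<in> S" "k y - k x = g z \<bullet> (y - x)" using smooth_bound_mvt[OF assms] .
  have "\<bar>g z \<bullet> (y - x)\<bar> \<le> norm (g z) * norm (y - x)" by (rule Cauchy_Schwarz_ineq2)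
  also have "\<dots> \<le> B * norm (y - x)" using smooth_boundD(3)[OF k z(1)] by (rule mult_right_mono) simp
  finally show ?thesis using z by (simp add: norm_minus_commute abs_minus_commute)
qed

text \<open>The gradient at the intermediate point differs from \<open>g x\<close> by at most
  \<open>B * norm (y - x)\<close>. This gives the constant \<open>B\<close> instead of the sharper
  \<open>B / 2\<close>, which is enough here.\<close>

lemma smooth_bound_descent:
  assumes k: "smooth_bound S B k g" and S: "convex S" "x \<in> S" "y \<in> S"
  shows "k y \<le> k x + g x \<bullet> (y - x) + B * (norm (y - x))\<^sup>2"
proof -
  obtain z where z: "z \<in> S" "norm (z - x) \<le> norm (y - x)" "k y - k x = g z \<bullet> (y - x)"
    using smooth_bound_mvt[OF assms] .
  have "0 \<le> B" using smooth_boundD(1)[OF k S(2)] by linarith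
  have "(g z - g x) \<bullet> (y - x) \<le> norm (g z - g x) * norm (y - x)" by (rule norm_cauchy_schwarz)
  also have "\<dots> \<le> (B * norm (z - x)) * norm (y - x)"
    using smooth_boundD(4)[OF k z(1) S(2)] by (rule mult_right_mono) simp
  also have "\<dots> \<le> (B * norm (y - x)) * norm (y - x)"
    using z(2) \<open>0 \<le> B\<close> by (intro mult_right_mono mult_left_mono) auto
  finally show ?thesis using z(3) by (simp add: inner_diff_left power2_eq_square)
qed

lemma smooth_bound_add:
  assumes "smooth_bound S B k g" "smooth_bound S B' k' g'"
  shows "smooth_bound S (B + B') (\<lambda>x. k x + k' x) (\<lambda>x. g x + g' x)"
  unfolding smooth_bound_def
proof (intro ballI conjI)
  fix x assume x: "x \<in> S"
  note D = smooth_boundD[OF assms(1) x] and D' = smooth_boundD[OF assms(2) x]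
  show "\<bar>k x + k' x\<bar> \<le> B + B'" using D(1) D'(1) by linarith
  show "GDERIV (\<lambda>x. k x + k' x) x :> g x + g' x" using D(2) D'(2) by (rule GDERIV_add)
  show "norm (g x + g' x) \<le> B + B'" using D(3) D'(3) by (rule norm_triangle_mono)
  fix y assume y: "y \<in> S"
  have "norm ((g x - g y) + (g' x - g' y)) \<le> B * norm (x - y) + B' * norm (x - y)"
    using D(4)[OF y] D'(4)[OF y] by (rule norm_triangle_mono)
  then show "norm (g x + g' x - (g y + g' y)) \<le> (B + B') * norm (x - y)"
    by (simp add: algebra_simps)
qed

lemma smooth_bound_cmult:
  assumes "smooth_bound S B k g"
  shows "smooth_bound S (\<bar>a\<bar> * B) (\<lambda>x. a * k x) (\<lambda>x. a *\<^sub>R g x)"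
  unfolding smooth_bound_def
proof (intro ballI conjI)
  fix x assume x: "x \<in> S"
  note D = smooth_boundD[OF assms x]
  show "\<bar>a * k x\<bar> \<le> \<bar>a\<bar> * B" using D(1) by (simp add: abs_mult mult_left_mono)
  show "GDERIV (\<lambda>x. a * k x) x :> a *\<^sub>R g x" using GDERIV_mult[OF GDERIV_const D(2), of a] by simp
  show "norm (a *\<^sub>R g x) \<le> \<bar>a\<bar> * B" using D(3) by (simp add: mult_left_mono)
  fix y assume y: "y \<in> S"
  show "norm (a *\<^sub>R g x - a *\<^sub>R g y) \<le> \<bar>a\<bar> * B * norm (x - y)"
    using mult_left_mono[OF D(4)[OF y], of "\<bar>a\<bar>"]
    by (simp flip: scaleR_diff_right add: mult.assoc)
qed

lemma smooth_bound_convex_combination: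
  assumes "smooth_bound S B k g" "smooth_bound S B k' g'" "0 \<le> a" "a \<le> 1"
  shows "smooth_bound S B (\<lambda>x. (1 - a) * k x + a * k' x) (\<lambda>x. (1 - a) *\<^sub>R g x + a *\<^sub>R g' x)"
  using smooth_bound_add[OF smooth_bound_cmult[OF assms(1), of "1 - a"] smooth_bound_cmult[OF assms(2), of a]]
    assms(3,4) by (simp add: algebra_simps)

text \<open>The factor 4 comes from the Lipschitz bound: the difference of the product gradients
  splits into four mixed terms, each at most \<open>B * B' * norm (x - y)\<close>.\<close>

lemma smooth_bound_mult:
  assumes k: "smooth_bound S B k g" and k': "smooth_bound S B' k' g'" and S: "convex S"
  shows "smooth_bound S (4 * (B * B')) (\<lambda>x. k x * k' x) (\<lambda>x. k x *\<^sub>R g' x + k' x *\<^sub>R g x)"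
  unfolding smooth_bound_def
proof (intro ballI conjI)
  fix x assume x: "x \<in> S"
  note D = smooth_boundD[OF k x] and D' = smooth_boundD[OF k' x]
  have B: "0 \<le> B" "0 \<le> B'" using D(1) D'(1) by linarith+
  have prod: "norm (s *\<^sub>R v) \<le> b * b'" if "\<bar>s\<bar> \<le> b" "norm v \<le> b'" for s b b' and v :: 'a
    using mult_mono[OF that] that by simp
  have "\<bar>k x * k' x\<bar> \<le> B * B'" using mult_mono[OF D(1) D'(1)] B by (simp add: abs_mult)
  then show "\<bar>k x * k' x\<bar> \<le> 4 * (B * B')" using B by simp
  show "GDERIV (\<lambda>x. k x * k' x) x :> k x *\<^sub>R g' x + k' x *\<^sub>R g x" using D(2) D'(2) by (rule GDERIV_mult)
  have "norm (k x *\<^sub>R g' x + k' x *\<^sub>R g x) \<le> B * B' + B' * B"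
    by (intro norm_triangle_mono prod D D')
  then show "norm (k x *\<^sub>R g' x + k' x *\<^sub>R g x) \<le> 4 * (B * B')"
    using mult_nonneg_nonneg[OF B] by (simp add: mult.commute)
  fix y assume y: "y \<in> S"
  note E = smooth_boundD[OF k y] and E' = smooth_boundD[OF k' y]
  have "(k x *\<^sub>R g' x + k' x *\<^sub>R g x) - (k y *\<^sub>R g' y + k' y *\<^sub>R g y)
    = ((k x - k y) *\<^sub>R g' x + k y *\<^sub>R (g' x - g' y)) + ((k' x - k' y) *\<^sub>R g x + k' y *\<^sub>R (g x - g y))"
    by (simp add: algebra_simps)
  also have "norm \<dots> \<le> ((B * norm (x - y)) * B' + B * (B' * norm (x - y)))
      + ((B' * norm (x - y)) * B + B' * (B * norm (x - y)))"
    by (intro norm_triangle_mono prod D D' E E' y smooth_bound_lipschitz[OF k S x y]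
        smooth_bound_lipschitz[OF k' S x y])
  finally show "norm ((k x *\<^sub>R g' x + k' x *\<^sub>R g x) - (k y *\<^sub>R g' y + k' y *\<^sub>R g y))
      \<le> 4 * (B * B') * norm (x - y)" by (simp add: algebra_simps)
qed

section \<open>Closure properties of families with a common smoothness constant\<close>

text \<open>The bound is chosen before the parameter, while the gradient may depend on it. Closure
  under sums and products covers polynomials whose coefficients range over bounded sets.\<close>

definition uniformly_smooth :: "'a::real_inner set \<Rightarrow> 'p set \<Rightarrow> ('p \<Rightarrow> 'a \<Rightarrow> real) \<Rightarrow> bool" where
  "uniformly_smooth S P k \<longleftrightarrow> (\<exists>B\<ge>0. \<forall>p\<in>P. \<exists>g. smooth_bound S B (k p) g)"

lemma uniformly_smooth_const:
  assumes "bounded (h ` P)"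
  shows "uniformly_smooth S P (\<lambda>p x. h p)"
proof -
  obtain B where "B > 0" "\<forall>v\<in>h ` P. norm v \<le> B" using assms by (auto simp: bounded_pos)
  then show ?thesis unfolding uniformly_smooth_def smooth_bound_def
    by (intro exI[of _ B] conjI ballI exI[of _ "\<lambda>_. 0"]) (auto intro: GDERIV_const)
qed

lemma uniformly_smooth_constant: "uniformly_smooth S P (\<lambda>p x. a)"
  by (rule uniformly_smooth_const) (simp add: image_constant_conv)

lemma uniformly_smooth_add:
  assumes "uniformly_smooth S P k" "uniformly_smooth S P k'"
  shows "uniformly_smooth S P (\<lambda>p x. k p x + k' p x)"
proof -
  obtain B B' where "B \<ge> 0" "B' \<ge> 0" "\<forall>p\<in>P. \<exists>g. smooth_bound S B (k p) g"
    "\<forall>p\<in>P. \<exists>g. smooth_bound S B' (k' p) g"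
    using assms by (auto simp: uniformly_smooth_def)
  then show ?thesis unfolding uniformly_smooth_def
    using smooth_bound_add by (intro exI[of _ "B + B'"]) fastforce
qed

lemma uniformly_smooth_mult:
  assumes "uniformly_smooth S P k" "uniformly_smooth S P k'" "convex S"
  shows "uniformly_smooth S P (\<lambda>p x. k p x * k' p x)"
proof -
  obtain B B' where "B \<ge> 0" "B' \<ge> 0" "\<forall>p\<in>P. \<exists>g. smooth_bound S B (k p) g"
    "\<forall>p\<in>P. \<exists>g. smooth_bound S B' (k' p) g"
    using assms(1,2) by (auto simp: uniformly_smooth_def)
  then show ?thesis unfolding uniformly_smooth_def
    using smooth_bound_mult[OF _ _ assms(3)] by (intro exI[of _ "4 * (B * B')"]) fastforce
qed

lemma uniformly_smooth_sum:
  assumes "\<And>i. i \<in> A \<Longrightarrow> uniformly_smooth S P (k i)"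
  shows "uniformly_smooth S P (\<lambda>p x. \<Sum>i\<in>A. k i p x)"
  using assms
proof (induction A rule: infinite_finite_induct)
  case (insert i A) then show ?case by (simp add: uniformly_smooth_add)
qed (simp_all add: uniformly_smooth_constant)

lemma uniformly_smooth_prod:
  assumes "\<And>i. i \<in> A \<Longrightarrow> uniformly_smooth S P (k i)" "convex S"
  shows "uniformly_smooth S P (\<lambda>p x. \<Prod>i\<in>A. k i p x)"
  using assms
proof (induction A rule: infinite_finite_induct)
  case (insert i A) then show ?case by (simp add: uniformly_smooth_mult)
qed (simp_all add: uniformly_smooth_constant)

lemma uniformly_smooth_inner:
  assumes "bounded S"
  shows "uniformly_smooth S P (\<lambda>p x. x \<bullet> v)"
proof -
  obtain B where B: "B > 0" "\<forall>x\<in>S. norm x \<le> B" using assms by (auto simp: bounded_pos)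
  have "GDERIV (\<lambda>x. x \<bullet> v) x :> v" for x
    unfolding gderiv_def by (auto intro!: derivative_eq_intros)
  moreover have "\<bar>x \<bullet> v\<bar> \<le> B * norm v + norm v" if "x \<in> S" for x
    using Cauchy_Schwarz_ineq2[of x v] mult_right_mono[of "norm x" B "norm v"] B(2) that
    by (smt (verit) norm_ge_zero)
  ultimately have "smooth_bound S (B * norm v + norm v) (\<lambda>x. x \<bullet> v) (\<lambda>_. v)"
    using B(1) by (auto simp: smooth_bound_def)
  then show ?thesis unfolding uniformly_smooth_def using B(1)
    by (intro exI[of _ "B * norm v + norm v"]) auto
qed

text \<open>The squared residual is a polynomial in the entries of \<open>D\<close> with
  coefficients from the bounded data and codes. The l1 penalty does not involve \<open>D\<close>, so
  its lack of smoothness in the code does no harm.\<close>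

lemma uniformly_smooth_code_loss:
  fixes S :: "('n::finite, 'k::finite, 'r::finite) mat_tuple set"
  assumes S: "convex S" "bounded S" and X: "bounded \<X>" and H: "bounded \<H>"
  shows "uniformly_smooth S (\<X> \<times> \<H>)
    (\<lambda>p D. code_loss lam I (fst p :: ('n, 'k, 'b::finite) tensor) D (snd p :: real^'b^'r))"
proof -
  have Hc: "bounded ((\<lambda>p. snd p $ r $ j) ` (\<X> \<times> \<H>))" for r j
  proof -
    have "bounded ((\<lambda>H. H $ r $ j) ` \<H>)"
      by (intro bounded_linear_image[OF H] bounded_linear_compose[OF bounded_linear_vec_nth bounded_linear_vec_nth])
    then show ?thesis by (rule bounded_subset) auto
  qed
  have Xc: "bounded ((\<lambda>p. fst p $ \<kappa> $ j) ` (\<X> \<times> \<H>))" for \<kappa> j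
  proof -
    have "bounded ((\<lambda>H. H $ \<kappa> $ j) ` \<X>)"
      by (intro bounded_linear_image[OF X] bounded_linear_compose[OF bounded_linear_vec_nth bounded_linear_vec_nth])
    then show ?thesis by (rule bounded_subset) auto
  qed
  have coord: "uniformly_smooth S (\<X> \<times> \<H>) (\<lambda>p D. D $ i $ k $ r)" for i k r
    using uniformly_smooth_inner[OF S(2), of _ "axis i (axis k (axis r 1))"] by (simp add: inner_axis)
  have out: "uniformly_smooth S (\<X> \<times> \<H>) (\<lambda>p D. Out I D $ \<kappa> $ r)" for \<kappa> r
  proof (cases "\<forall>i. \<kappa> i \<in> I i")
    case True
    then show ?thesis by (simp add: Out_def uniformly_smooth_prod[OF coord S(1)])
  next
    case False
    then have "Out I D $ \<kappa> $ r = 0" for D :: "('n, 'k, 'r) mat_tuple"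
      unfolding Out_def vec_lambda_beta by (rule if_not_P)
    then show ?thesis by (simp add: uniformly_smooth_constant)
  qed
  \<comment> \<open>The difference is written with a factor \<open>-1\<close> so that closure under
    sums and products suffices.\<close>
  have res: "uniformly_smooth S (\<X> \<times> \<H>)
    (\<lambda>p D. fst p $ \<kappa> $ j + (-1) * (\<Sum>r\<in>UNIV. snd p $ r $ j * Out I D $ \<kappa> $ r))" for \<kappa> j
    by (intro uniformly_smooth_add uniformly_smooth_mult uniformly_smooth_sum out
        uniformly_smooth_const S Xc Hc) (auto simp: image_constant_conv)
  have "uniformly_smooth S (\<X> \<times> \<H>) (\<lambda>p D. (\<Sum>\<kappa>\<in>UNIV. \<Sum>j\<in>UNIV.
      (fst p $ \<kappa> $ j + (-1) * (\<Sum>r\<in>UNIV. snd p $ r $ j * Out I D $ \<kappa> $ r)) *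
      (fst p $ \<kappa> $ j + (-1) * (\<Sum>r\<in>UNIV. snd p $ r $ j * Out I D $ \<kappa> $ r)))
      + lam * l1_norm (snd p))"
  proof (rule uniformly_smooth_add[OF uniformly_smooth_sum[OF uniformly_smooth_sum[OF
          uniformly_smooth_mult[OF res res S(1)]]] uniformly_smooth_mult[OF uniformly_smooth_constant _ S(1)]])
    \<comment> \<open>The set of codes is only bounded here; passing to its compact closure bounds
      the penalty.\<close>
    have "continuous_on (closure \<H>) l1_norm"
      unfolding l1_norm_def by (intro continuous_intros)
    then have "bounded (l1_norm ` closure \<H>)"
      using H by (intro compact_imp_bounded compact_continuous_image)
        (simp_all add: compact_eq_bounded_closed bounded_closure)
    then have "bounded ((\<lambda>p. l1_norm (snd p)) ` (\<X> \<times> \<H>))"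
      by (rule bounded_subset) (auto intro: closure_subset[THEN subsetD])
    then show "uniformly_smooth S (\<X> \<times> \<H>) (\<lambda>p D. l1_norm (snd p))" by (rule uniformly_smooth_const)
  qed
  then show ?thesis
    by (simp add: code_loss_def power2_norm_eq_inner inner_vec_def mode_product_def)
qed

section \<open>Surrogate descent along a fixed path\<close>

text \<open>All randomness is frozen: \<open>y\<close> is one sample path and \<open>w t\<close> is
  the weight of step \<open>Suc t\<close>. The function \<open>k t\<close> is the code loss with its
  code held fixed; it majorizes the loss of the state \<open>y t\<close> and is exact at
  \<open>D t\<close>. \<open>F\<close> and \<open>e\<close> are the surrogate and the empirical
  loss. \<open>S\<close> leaves room of radius 1 around the dictionary set \<open>K\<close>, so
  gradients can be tested in every direction, even at boundary points of \<open>K\<close>. The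
  assumption \<open>progress\<close> is the Frank--Wolfe decrease of one sweep.\<close>

locale surrogate_descent =
  fixes w :: "nat \<Rightarrow> real" and S K :: "'a::euclidean_space set" and B c a b :: real
    and l :: "'s::finite \<Rightarrow> 'a \<Rightarrow> real" and p :: "'s \<Rightarrow> real" and y :: "nat \<Rightarrow> 's"
    and k :: "nat \<Rightarrow> 'a \<Rightarrow> real" and gk :: "nat \<Rightarrow> 'a \<Rightarrow> 'a"
    and F e :: "nat \<Rightarrow> 'a \<Rightarrow> real" and D :: "nat \<Rightarrow> 'a"
  assumes w: "\<And>t. 0 < w t \<and> w t \<le> 1" "\<And>t. w (Suc t) \<le> w t"
      "\<not> summable w" "summable (\<lambda>t. (w t)\<^sup>2)"
    and S: "convex S" and K: "compact K" "\<And>x. x \<in> K \<Longrightarrow> cball x 1 \<subseteq> S" and D_in: "\<And>t. D t \<in> K"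
    and l_bound: "\<And>s x. x \<in> S \<Longrightarrow> \<bar>l s x\<bar> \<le> B"
    and l_lipschitz: "\<And>s x x'. x \<in> S \<Longrightarrow> x' \<in> S \<Longrightarrow> \<bar>l s x - l s x'\<bar> \<le> B * norm (x - x')"
    and p: "\<And>s. 0 \<le> p s \<and> p s \<le> 1"
    and k_smooth: "\<And>t. smooth_bound S B (k t) (gk t)"
    and k_majorizes: "\<And>t x. x \<in> S \<Longrightarrow> l (y t) x \<le> k t x"
    and k_tight: "\<And>t. k t (D t) = l (y t) (D t)"
    and F_rec: "F 0 = (\<lambda>_. 0)" "\<And>t. F (Suc t) = (\<lambda>x. (1 - w t) * F t x + w t * k t x)"
    and e_rec: "e 0 = (\<lambda>_. 0)" "\<And>t. e (Suc t) = (\<lambda>x. (1 - w t) * e t x + w t * l (y t) x)"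
    and step: "\<And>t. norm (D (Suc t) - D t) \<le> c * w t"
    and progress: "\<And>t g V. smooth_bound S B (F (Suc t)) g \<Longrightarrow> V \<in> K \<Longrightarrow>
      F (Suc t) (D (Suc t)) \<le> F (Suc t) (D t) + a * w t * (g (D t) \<bullet> (V - D t)) + b * (w t)\<^sup>2"
    and a_pos: "0 < a"
    and q_summable: "\<And>s. summable (\<lambda>t. w t * \<bar>occupation_error w p y t s\<bar>)"
begin

abbreviation q where "q \<equiv> occupation_error w p y"

definition f where "f x = (\<Sum>s\<in>UNIV. p s * l s x)"

text \<open>The fluctuation of the empirical around the expected loss, see \<open>e_eq\<close>. It
  is linear in the finitely many occupation errors, hence small uniformly in
  \<open>x\<close>.\<close>

definition r where "r t x = (\<Sum>s\<in>UNIV. q t s * l s x)"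

text \<open>A gradient of \<open>F t\<close> on \<open>S\<close>, see \<open>F_smooth\<close>. The
  recursion parallels that of \<open>F\<close>, so its change per step is of order
  \<open>w t\<close>.\<close>

primrec gF where
  "gF 0 = (\<lambda>_. 0)"
| "gF (Suc t) = (\<lambda>x. (1 - w t) *\<^sub>R gF t x + w t *\<^sub>R gk t x)"

declare gF.simps(2) [simp del]

text \<open>The Frank--Wolfe gap over \<open>K\<close>. The indices differ because step
  \<open>Suc t\<close> starts from \<open>D t\<close> and minimizes the surrogate
  \<open>F (Suc t)\<close>.\<close>

definition gap where "gap t = (SUP V\<in>K. gF (Suc t) (D t) \<bullet> (D t - V))"

section \<open>Bounds and one-step changes of the averaged losses\<close>

lemma K_S: "x \<in> K \<Longrightarrow> x \<in> S"
  using K(2)[of x] by auto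

lemma D_S: "D t \<in> S"
  using D_in K_S by blast

lemma B_nonneg: "0 \<le> B"
  using l_bound[OF D_S[of 0], of undefined] by linarith

lemma w_le: "0 \<le> w t \<and> w t \<le> 1"
  using w(1)[of t] by simp

lemma F_smooth: "smooth_bound S B (F t) (gF t)"
proof (induction t)
  case 0
  then show ?case using B_nonneg by (auto simp: smooth_bound_def F_rec GDERIV_const)
next
  case (Suc t)
  then show ?case using smooth_bound_convex_combination[OF Suc k_smooth] w_le by (simp add: F_rec gF.simps(2))
qed

lemma F_diff: "x \<in> S \<Longrightarrow> \<bar>F (Suc t) x - F t x\<bar> \<le> 2 * B * w t"
proof -
  assume x: "x \<in> S"
  have "F (Suc t) x - F t x = w t * (k t x - F t x)" by (simp add: F_rec algebra_simps)
  moreover have "\<bar>k t x - F t x\<bar> \<le> 2 * B"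
    using smooth_boundD(1)[OF k_smooth x, of t] smooth_boundD(1)[OF F_smooth x, of t] by linarith
  ultimately show ?thesis using w_le[of t] by (simp add: abs_mult mult.commute mult_left_mono)
qed

lemma gF_diff: "x \<in> S \<Longrightarrow> norm (gF (Suc t) x - gF t x) \<le> 2 * B * w t"
proof -
  assume x: "x \<in> S"
  have "gF (Suc t) x - gF t x = w t *\<^sub>R (gk t x - gF t x)" by (simp add: gF.simps(2) algebra_simps)
  moreover have "norm (gk t x - gF t x) \<le> 2 * B"
    using norm_triangle_ineq4[of "gk t x" "gF t x"]
      smooth_boundD(3)[OF k_smooth x, of t] smooth_boundD(3)[OF F_smooth x, of t] by linarith
  ultimately show ?thesis using w_le[of t] by (simp add: mult.commute mult_left_mono)
qed

lemma e_bound: "x \<in> S \<Longrightarrow> \<bar>e t x\<bar> \<le> B"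
proof (induction t)
  case 0
  then show ?case using B_nonneg by (simp add: e_rec)
next
  case (Suc t)
  have "\<bar>(1 - w t) * e t x\<bar> \<le> (1 - w t) * B" "\<bar>w t * l (y t) x\<bar> \<le> w t * B"
    using Suc l_bound[OF \<open>x \<in> S\<close>] w_le[of t] by (simp_all add: abs_mult mult_left_mono)
  then show ?case unfolding e_rec by (simp add: algebra_simps abs_le_iff) linarith
qed

lemma e_diff: "x \<in> S \<Longrightarrow> \<bar>e (Suc t) x - e t x\<bar> \<le> 2 * B * w t"
proof -
  assume x: "x \<in> S"
  have "e (Suc t) x - e t x = w t * (l (y t) x - e t x)" by (simp add: e_rec algebra_simps)
  moreover have "\<bar>l (y t) x - e t x\<bar> \<le> 2 * B"
    using l_bound[OF x, of "y t"] e_bound[OF x, of t] by linarith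
  ultimately show ?thesis using w_le[of t] by (simp add: abs_mult mult.commute mult_left_mono)
qed

lemma e_lipschitz:
  assumes "x \<in> S" "x' \<in> S"
  shows "\<bar>e t x - e t x'\<bar> \<le> B * norm (x - x')"
proof (induction t)
  case 0
  then show ?case using B_nonneg by (simp add: e_rec)
next
  case (Suc t)
  have "\<bar>(1 - w t) * (e t x - e t x')\<bar> \<le> (1 - w t) * (B * norm (x - x'))"
    "\<bar>w t * (l (y t) x - l (y t) x')\<bar> \<le> w t * (B * norm (x - x'))"
    using Suc l_lipschitz[OF assms] w_le[of t] by (simp_all add: abs_mult mult_left_mono)
  then show ?case unfolding e_rec by (simp add: algebra_simps abs_le_iff) linarith
qed

lemma e_le_F: "x \<in> S \<Longrightarrow> e t x \<le> F t x"
proof (induction t)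
  case (Suc t)
  then show ?case unfolding e_rec F_rec using w_le[of t] k_majorizes[of x t]
    by (intro add_mono mult_left_mono) auto
qed (simp add: e_rec F_rec)

text \<open>Both sides obey the same averaging recursion. The initial error \<open>- p s\<close>
  makes \<open>r 0 = - f\<close>, which matches \<open>e 0 = 0\<close>.\<close>

lemma e_eq: "e t x = f x + r t x"
proof (induction t)
  case 0
  then show ?case by (simp add: e_rec f_def r_def sum_negf)
next
  case (Suc t)
  have "r (Suc t) x = (\<Sum>s\<in>UNIV. (1 - w t) * (q t s * l s x)
      + (w t * (if y t = s then l s x else 0) - w t * (p s * l s x)))"
    unfolding r_def by (intro sum.cong refl) (simp add: algebra_simps)
  also have "\<dots> = (1 - w t) * r t x + w t * (l (y t) x - f x)"
    by (simp only: sum.distrib sum_subtractf flip: sum_distrib_left) (simp add: r_def f_def algebra_simps)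
  finally show ?case using Suc by (simp add: e_rec algebra_simps)
qed

section \<open>Uniform smallness of the fluctuation\<close>

lemma q_tendsto: "(\<lambda>t. q t s) \<longlonglongrightarrow> 0"
proof -
  have "(\<lambda>t. \<bar>q t s\<bar>) \<longlonglongrightarrow> 0"
  proof (rule tendsto_0_of_summable_mult[OF _ _ q_summable w(4) w(3)])
    show "\<bar>\<bar>q (Suc n) s\<bar> - \<bar>q n s\<bar>\<bar> \<le> 2 * w n" for n
      using occupation_error_diff[where w=w and p=p and s=s and y=y and t=n, OF w_le] p[of s] by linarith
  qed (use w_le in auto)
  then show ?thesis by (rule tendsto_rabs_zero_cancel)
qed

lemma sum_q_tendsto: "(\<lambda>t. \<Sum>s\<in>UNIV. \<bar>q t s\<bar>) \<longlonglongrightarrow> 0"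
  using tendsto_sum[of UNIV "\<lambda>s t. \<bar>q t s\<bar>" "\<lambda>_. 0" sequentially] tendsto_rabs_zero[OF q_tendsto] by simp

lemma r_bound: "x \<in> S \<Longrightarrow> \<bar>r t x\<bar> \<le> B * (\<Sum>s\<in>UNIV. \<bar>q t s\<bar>)"
proof -
  assume x: "x \<in> S"
  have "\<bar>r t x\<bar> \<le> (\<Sum>s\<in>UNIV. \<bar>q t s * l s x\<bar>)" unfolding r_def by (rule sum_abs)
  also have "\<dots> \<le> (\<Sum>s\<in>UNIV. B * \<bar>q t s\<bar>)"
    using l_bound[OF x] by (intro sum_mono) (simp add: abs_mult mult.commute[of B] mult_left_mono)
  finally show ?thesis by (simp add: sum_distrib_left)
qed

text \<open>The Lipschitz constant itself contains the occupation errors. As an iterate moves by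
  \<open>O(w t)\<close>, the resulting change of \<open>r\<close> is summable.\<close>

lemma r_lipschitz:
  assumes "x \<in> S" "x' \<in> S"
  shows "\<bar>r t x - r t x'\<bar> \<le> B * norm (x - x') * (\<Sum>s\<in>UNIV. \<bar>q t s\<bar>)"
proof -
  have "r t x - r t x' = (\<Sum>s\<in>UNIV. q t s * (l s x - l s x'))"
    by (simp add: r_def sum_subtractf algebra_simps)
  also have "\<bar>\<dots>\<bar> \<le> (\<Sum>s\<in>UNIV. \<bar>q t s * (l s x - l s x')\<bar>)" by (rule sum_abs)
  also have "\<dots> \<le> (\<Sum>s\<in>UNIV. B * norm (x - x') * \<bar>q t s\<bar>)"
    using l_lipschitz[OF assms]
    by (intro sum_mono) (simp add: abs_mult mult.commute[of "B * _"] mult_left_mono)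
  finally show ?thesis by (simp add: sum_distrib_left)
qed

text \<open>Stated for moving points and arbitrary times tending to infinity, since it is needed
  along subsequences of iterates.\<close>

lemma r_tendsto:
  assumes "filterlim \<tau> at_top sequentially" "\<And>n. x n \<in> S"
  shows "(\<lambda>n. r (\<tau> n) (x n)) \<longlonglongrightarrow> 0"
proof (rule Lim_null_comparison)
  show "\<forall>\<^sub>F n in sequentially. norm (r (\<tau> n) (x n)) \<le> B * (\<Sum>s\<in>UNIV. \<bar>q (\<tau> n) s\<bar>)"
    using r_bound assms(2) by simp
  show "(\<lambda>n. B * (\<Sum>s\<in>UNIV. \<bar>q (\<tau> n) s\<bar>)) \<longlonglongrightarrow> 0"
    using tendsto_mult_right_zero[OF filterlim_compose[OF sum_q_tendsto assms(1)]] by simp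
qed

section \<open>The Frank--Wolfe gap and the descent inequality\<close>

lemma gap_bdd: "bdd_above ((\<lambda>V. gF (Suc t) (D t) \<bullet> (D t - V)) ` K)"
proof -
  have "compact ((\<lambda>V. gF (Suc t) (D t) \<bullet> (D t - V)) ` K)"
    using K(1) by (intro compact_continuous_image continuous_intros)
  then show ?thesis by (intro bounded_imp_bdd_above compact_imp_bounded)
qed

lemma gap_ge: "V \<in> K \<Longrightarrow> gF (Suc t) (D t) \<bullet> (D t - V) \<le> gap t"
  unfolding gap_def by (rule cSUP_upper[OF _ gap_bdd])

lemma gap_nonneg: "0 \<le> gap t"
  using gap_ge[OF D_in, of t t] by simp

lemma F_along_diff: "\<bar>F (Suc t) (D (Suc t)) - F t (D t)\<bar> \<le> (B * c + 2 * B) * w t"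
proof -
  have "\<bar>F (Suc t) (D (Suc t)) - F (Suc t) (D t)\<bar> \<le> B * (c * w t)"
    using smooth_bound_lipschitz[OF F_smooth S D_S D_S] mult_left_mono[OF step B_nonneg] by (rule order_trans)
  then show ?thesis using F_diff[OF D_S, of t t] by (simp add: algebra_simps)
qed

lemma e_along_diff: "\<bar>e (Suc t) (D (Suc t)) - e t (D t)\<bar> \<le> (B * c + 2 * B) * w t"
proof -
  have "\<bar>e (Suc t) (D (Suc t)) - e (Suc t) (D t)\<bar> \<le> B * (c * w t)"
    using e_lipschitz[OF D_S D_S] mult_left_mono[OF step B_nonneg] by (rule order_trans)
  then show ?thesis using e_diff[OF D_S, of t t] by (simp add: algebra_simps)
qed

lemma gF_along_diff:
  "norm (gF (Suc (Suc t)) (D (Suc t)) - gF (Suc t) (D t)) \<le> (B * c + 2 * B) * w t"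
proof -
  have "norm (gF (Suc t) (D (Suc t)) - gF (Suc t) (D t)) \<le> B * (c * w t)"
    using smooth_boundD(4)[OF F_smooth D_S D_S] mult_left_mono[OF step B_nonneg] by (rule order_trans)
  moreover have "norm (gF (Suc (Suc t)) (D (Suc t)) - gF (Suc t) (D (Suc t))) \<le> 2 * B * w t"
    using gF_diff[OF D_S, of "Suc t" "Suc t"] mult_left_mono[OF w(2)[of t], of "2 * B"] B_nonneg by simp
  ultimately show ?thesis
    using norm_triangle_ineq[of "gF (Suc (Suc t)) (D (Suc t)) - gF (Suc t) (D (Suc t))"
        "gF (Suc t) (D (Suc t)) - gF (Suc t) (D t)"]
    by (simp add: algebra_simps)
qed

text \<open>The first term is the second-order error of a sweep, the second is the change of
  \<open>r (Suc t)\<close> when the iterate moves from \<open>D t\<close> to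
  \<open>D (Suc t)\<close>.\<close>

definition err where "err t = b * (w t)\<^sup>2 + B * c * (w t * (\<Sum>s\<in>UNIV. \<bar>q (Suc t) s\<bar>))"

lemma err_summable: "summable err"
proof -
  \<comment> \<open>Replacing \<open>q (Suc t)\<close> by \<open>q t\<close> costs at most
    \<open>2 * w t\<close>, which becomes a square of the weight.\<close>
  have "summable (\<lambda>t. w t * \<bar>q (Suc t) s\<bar>)" for s
  proof (rule summable_comparison_test')
    show "summable (\<lambda>t. w t * \<bar>q t s\<bar> + 2 * (w t)\<^sup>2)"
      by (intro summable_add q_summable summable_mult w)
    show "norm (w t * \<bar>q (Suc t) s\<bar>) \<le> w t * \<bar>q t s\<bar> + 2 * (w t)\<^sup>2" for t
    proof -
      have "\<bar>q (Suc t) s\<bar> \<le> \<bar>q t s\<bar> + 2 * w t"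
        using occupation_error_diff[where w=w and p=p and s=s and y=y and t=t, OF w_le] p[of s] by linarith
      from mult_left_mono[OF this, of "w t"] show ?thesis
        using w_le[of t] by (simp add: abs_mult algebra_simps power2_eq_square)
    qed
  qed
  then have "summable (\<lambda>t. w t * (\<Sum>s\<in>UNIV. \<bar>q (Suc t) s\<bar>))"
    by (simp add: sum_distrib_left summable_sum)
  then show ?thesis unfolding err_def by (intro summable_add summable_mult w)
qed

text \<open>Subtracting the fluctuation \<open>r\<close> turns the surrogate value along the iterates into an
  almost decreasing sequence, so no information on how the iterates depend on the data is needed.\<close>

definition v where "v t = F t (D t) - r t (D t)"

text \<open>First the loss index advances at the fixed point \<open>D t\<close>: by
  \<open>k_tight\<close>, surrogate and empirical loss receive the same new value, which cancels and
  leaves a drop of \<open>w t\<close> times their difference. Then the point moves, and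
  \<open>progress\<close> yields the gap.\<close>

lemma v_step: "w t * (F t (D t) - e t (D t)) + a * (w t * gap t) \<le> v t - v (Suc t) + err t"
proof -
  have "F (Suc t) (D t) = F t (D t) + w t * (l (y t) (D t) - F t (D t))"
    by (simp add: F_rec k_tight algebra_simps)
  moreover have "e (Suc t) (D t) = e t (D t) + w t * (l (y t) (D t) - e t (D t))"
    by (simp add: e_rec algebra_simps)
  ultimately have drift: "F (Suc t) (D t) - r (Suc t) (D t) = v t - w t * (F t (D t) - e t (D t))"
    unfolding v_def e_eq by (simp add: algebra_simps)
  have "\<bar>r (Suc t) (D (Suc t)) - r (Suc t) (D t)\<bar>
      \<le> B * norm (D (Suc t) - D t) * (\<Sum>s\<in>UNIV. \<bar>q (Suc t) s\<bar>)" by (rule r_lipschitz[OF D_S D_S])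
  also have "\<dots> \<le> B * (c * w t) * (\<Sum>s\<in>UNIV. \<bar>q (Suc t) s\<bar>)"
    using B_nonneg step by (intro mult_right_mono mult_left_mono sum_nonneg) auto
  finally have "r (Suc t) (D t) - r (Suc t) (D (Suc t)) \<le> B * c * (w t * (\<Sum>s\<in>UNIV. \<bar>q (Suc t) s\<bar>))"
    by (simp add: algebra_simps)
  then have V: "a * w t * (gF (Suc t) (D t) \<bullet> (D t - V))
      \<le> v t - v (Suc t) + err t - w t * (F t (D t) - e t (D t))" if "V \<in> K" for V
    using progress[OF F_smooth that, of t] drift
    unfolding v_def err_def inner_diff_right by (simp only: algebra_simps)
  \<comment> \<open>Dividing by the positive factor \<open>a * w t\<close> isolates the inner
    product, so the supremum over \<open>V\<close> can be taken.\<close>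
  have "gap t \<le> (v t - v (Suc t) + err t - w t * (F t (D t) - e t (D t))) / (a * w t)"
    unfolding gap_def
  proof (rule cSUP_least)
    show "K \<noteq> {}" using D_in by blast
    fix V assume "V \<in> K"
    then show "gF (Suc t) (D t) \<bullet> (D t - V)
        \<le> (v t - v (Suc t) + err t - w t * (F t (D t) - e t (D t))) / (a * w t)"
      using V a_pos w(1)[of t] by (simp add: pos_le_divide_eq mult.commute)
  qed
  then have "gap t * (a * w t) \<le> v t - v (Suc t) + err t - w t * (F t (D t) - e t (D t))"
    using a_pos w(1)[of t] by (simp add: pos_le_divide_eq)
  then show ?thesis by (simp add: algebra_simps)
qed

lemma v_ge: "- B - B * real CARD('s) \<le> v t"
proof -
  have "(\<Sum>s\<in>UNIV. \<bar>q t s\<bar>) \<le> (\<Sum>s\<in>(UNIV::'s set). 1)"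
    using occupation_error_bound[where w=w and p=p, OF w_le] p by (intro sum_mono) blast
  then have "B * (\<Sum>s\<in>UNIV. \<bar>q t s\<bar>) \<le> B * real CARD('s)"
    using B_nonneg by (intro mult_left_mono) auto
  then show ?thesis
    using r_bound[OF D_S, of t t] smooth_boundD(1)[OF F_smooth D_S, of t t] unfolding v_def by linarith
qed

section \<open>Limits along the path\<close>

lemma gap_tendsto: "gap \<longlonglongrightarrow> 0"
proof -
  have Fe: "0 \<le> w t * (F t (D t) - e t (D t))" for t
    using e_le_F[OF D_S] w_le by simp
  have "summable (\<lambda>t. a * (w t * gap t))"
  proof (rule summable_of_le_diff[OF _ _ err_summable v_ge])
    show "0 \<le> a * (w t * gap t)" for t using a_pos w_le[of t] gap_nonneg by simp
    show "a * (w t * gap t) \<le> v t - v (Suc t) + err t" if "0 \<le> t" for t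
      using v_step[of t] Fe[of t] by linarith
  qed
  then have summable: "summable (\<lambda>t. w t * gap t)" using a_pos by (simp add: summable_cmult_iff)
  obtain R where R: "\<And>x. x \<in> K \<Longrightarrow> norm x \<le> R"
    using compact_imp_bounded[OF K(1)] by (auto simp: bounded_iff)
  show ?thesis
  proof (rule tendsto_0_of_summable_mult[OF _ gap_nonneg summable w(4) w(3)])
    \<comment> \<open>The first part is the change of the gradient times the diameter bound
      \<open>2 * R\<close>, the second is the gradient bound times the move of the iterate; both are
      uniform in \<open>V\<close>.\<close>
    show "\<bar>gap (Suc t) - gap t\<bar> \<le> ((B * c + 2 * B) * (2 * R) + B * c) * w t" for t
      unfolding gap_def
    proof (rule abs_SUP_diff_le[OF _ gap_bdd gap_bdd])
      show "K \<noteq> {}" using D_in by blast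
      fix V assume V: "V \<in> K"
      let ?g' = "gF (Suc (Suc t)) (D (Suc t))" and ?g = "gF (Suc t) (D t)"
      have "norm (D (Suc t) - V) \<le> 2 * R"
        using norm_triangle_ineq4[of "D (Suc t)" V] R[OF V] R[OF D_in, of "Suc t"] by linarith
      then have "norm (?g' - ?g) * norm (D (Suc t) - V) \<le> ((B * c + 2 * B) * w t) * (2 * R)"
        using gF_along_diff[of t] by (intro mult_mono) (auto intro: order_trans[OF norm_ge_zero])
      then have "\<bar>(?g' - ?g) \<bullet> (D (Suc t) - V)\<bar> \<le> ((B * c + 2 * B) * w t) * (2 * R)"
        using Cauchy_Schwarz_ineq2 order_trans by blast
      moreover have "norm ?g * norm (D (Suc t) - D t) \<le> B * (c * w t)"
        using smooth_boundD(3)[OF F_smooth D_S] step B_nonneg by (intro mult_mono) auto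
      then have "\<bar>?g \<bullet> (D (Suc t) - D t)\<bar> \<le> B * (c * w t)"
        using Cauchy_Schwarz_ineq2 order_trans by blast
      moreover have "?g' \<bullet> (D (Suc t) - V) - ?g \<bullet> (D t - V)
          = (?g' - ?g) \<bullet> (D (Suc t) - V) + ?g \<bullet> (D (Suc t) - D t)"
        by (simp add: inner_diff_left inner_diff_right)
      ultimately show "\<bar>?g' \<bullet> (D (Suc t) - V) - ?g \<bullet> (D t - V)\<bar>
          \<le> ((B * c + 2 * B) * (2 * R) + B * c) * w t"
        by (simp add: algebra_simps)
    qed
  qed (use w_le in auto)
qed

text \<open>The same argument as for the gap, now keeping the other nonnegative term of
  \<open>v_step\<close>.\<close>

lemma emp_sur_tendsto: "(\<lambda>t. F t (D t) - e t (D t)) \<longlonglongrightarrow> 0"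
proof (rule tendsto_0_of_summable_mult[OF _ _ _ w(4) w(3)])
  show Fe: "0 \<le> F t (D t) - e t (D t)" for t using e_le_F[OF D_S] by simp
  show "summable (\<lambda>t. w t * (F t (D t) - e t (D t)))"
  proof (rule summable_of_le_diff[OF _ _ err_summable v_ge])
    show "0 \<le> w t * (F t (D t) - e t (D t))" for t using Fe w_le by simp
    have "0 \<le> a * (w t * gap t)" for t using a_pos w_le[of t] gap_nonneg by simp
    then show "w t * (F t (D t) - e t (D t)) \<le> v t - v (Suc t) + err t" if "0 \<le> t" for t
      using v_step[of t] by (smt (verit))
  qed
  show "\<bar>F (Suc t) (D (Suc t)) - e (Suc t) (D (Suc t)) - (F t (D t) - e t (D t))\<bar>
      \<le> (2 * (B * c + 2 * B)) * w t" for t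
    using F_along_diff[of t] e_along_diff[of t] by (simp add: algebra_simps)
qed (use w_le in auto)

lemma exp_sur_tendsto: "(\<lambda>t. f (D t) - F t (D t)) \<longlonglongrightarrow> 0"
proof -
  have "(\<lambda>t. - (F t (D t) - e t (D t)) - r t (D t)) \<longlonglongrightarrow> - 0 - 0"
    by (intro tendsto_diff tendsto_minus emp_sur_tendsto r_tendsto filterlim_ident D_S)
  then show ?thesis by (simp add: e_eq algebra_simps)
qed

text \<open>The corrected value \<open>v\<close> decreases up to the summable \<open>err\<close> and
  is bounded below, and the correction \<open>r\<close> vanishes in the limit.\<close>

lemma sur_convergent: "convergent (\<lambda>t. F t (D t))"
proof -
  have "convergent v"
  proof (rule convergent_of_le_add_summable[OF _ err_summable v_ge])
    show "v (Suc t) \<le> v t + err t" for t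
    proof -
      have "0 \<le> w t * (F t (D t) - e t (D t)) + a * (w t * gap t)"
        using e_le_F[OF D_S] w_le[of t] gap_nonneg[of t] a_pos by simp
      then show ?thesis using v_step[of t] by linarith
    qed
  qed
  moreover have "convergent (\<lambda>t. r t (D t))"
    using r_tendsto[OF filterlim_ident D_S] by (rule convergentI)
  ultimately have "convergent (\<lambda>t. v t + r t (D t))" by (rule convergent_add)
  then show ?thesis by (simp add: v_def)
qed

lemma f_tendsto:
  assumes "x \<longlonglongrightarrow> x0" "\<And>n. x n \<in> S" "x0 \<in> S"
  shows "(\<lambda>n. f (x n)) \<longlonglongrightarrow> f x0"
  unfolding f_def
proof (intro tendsto_sum tendsto_mult tendsto_const)
  fix s
  have "(\<lambda>n. l s (x n) - l s x0) \<longlonglongrightarrow> 0"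
  proof (rule Lim_null_comparison)
    show "\<forall>\<^sub>F n in sequentially. norm (l s (x n) - l s x0) \<le> B * norm (x n - x0)"
      using l_lipschitz assms by simp
    show "(\<lambda>n. B * norm (x n - x0)) \<longlonglongrightarrow> 0"
      using assms(1) by (intro tendsto_mult_right_zero tendsto_norm_zero) (simp add: LIM_zero)
  qed
  then show "(\<lambda>n. l s (x n)) \<longlonglongrightarrow> l s x0" by (simp add: LIM_zero_iff)
qed

text \<open>At a limit point the surrogates touch the expected loss from above, which forces the two
  gradients to agree there.\<close>

lemma limit_point_stationary:
  assumes \<sigma>: "strict_mono \<sigma>" and lim: "(\<lambda>n. D (\<sigma> n)) \<longlonglongrightarrow> x" and G: "GDERIV f x :> G" and V: "V \<in> K"
  shows "0 \<le> G \<bullet> (V - x)"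
proof -
  have x: "x \<in> K" using closed_sequentially[OF compact_imp_closed[OF K(1)] _ lim] D_in by blast
  \<comment> \<open>The surrogate gradients are bounded, so a further subsequence of them converges
    to some \<open>g\<close>; that \<open>g\<close> is the gradient of \<open>f\<close> is only
    shown at the end.\<close>
  have "\<forall>n. gF (Suc (\<sigma> n)) (D (\<sigma> n)) \<in> cball 0 B"
    using smooth_boundD(3)[OF F_smooth D_S] by simp
  then obtain g \<rho> where \<rho>: "strict_mono \<rho>"
    and g_lim: "((\<lambda>n. gF (Suc (\<sigma> n)) (D (\<sigma> n))) \<circ> \<rho>) \<longlonglongrightarrow> g"
    using compact_cball[of "0::'a" B, unfolded compact_def, THEN spec,
        of "\<lambda>n. gF (Suc (\<sigma> n)) (D (\<sigma> n))"] by blast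
  define \<tau> where "\<tau> n = \<sigma> (\<rho> n)" for n
  have \<tau>: "filterlim \<tau> at_top sequentially"
    using filterlim_compose[OF filterlim_subseq[OF \<sigma>] filterlim_subseq[OF \<rho>]] by (simp add: \<tau>_def[abs_def])
  have g: "(\<lambda>n. gF (Suc (\<tau> n)) (D (\<tau> n))) \<longlonglongrightarrow> g"
    using g_lim by (simp add: \<tau>_def o_def)
  have D\<tau>: "(\<lambda>n. D (\<tau> n)) \<longlonglongrightarrow> x"
    using LIMSEQ_subseq_LIMSEQ[OF lim \<rho>] by (simp add: \<tau>_def o_def)
  have "g \<bullet> (x - V) \<le> 0"
  proof (rule LIMSEQ_le)
    show "(\<lambda>n. gF (Suc (\<tau> n)) (D (\<tau> n)) \<bullet> (D (\<tau> n) - V)) \<longlonglongrightarrow> g \<bullet> (x - V)"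
      by (intro tendsto_intros g D\<tau>)
    show "(\<lambda>n. gap (\<tau> n)) \<longlonglongrightarrow> 0" by (rule filterlim_compose[OF gap_tendsto \<tau>])
    show "\<exists>N. \<forall>n\<ge>N. gF (Suc (\<tau> n)) (D (\<tau> n)) \<bullet> (D (\<tau> n) - V) \<le> gap (\<tau> n)"
      using gap_ge[OF V] by blast
  qed
  \<comment> \<open>Limit of the inequality \<open>e \<le> F\<close> at
    \<open>D (\<tau> n) + h\<close>, with \<open>F\<close> bounded by the descent inequality around
    \<open>D (\<tau> n)\<close>. The restriction on \<open>h\<close> keeps these points in
    \<open>S\<close>.\<close>
  moreover have touch: "f (x + h) \<le> f x + g \<bullet> h + B * (norm h)\<^sup>2" if h: "norm h \<le> 1" for h
  proof (rule LIMSEQ_le)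
    have S': "z + h \<in> S" if "z \<in> K" for z
      using K(2)[OF that] h by (auto simp: dist_norm)
    have S\<tau>: "D (\<tau> n) + h \<in> S" for n using S' D_in by blast
    have Suc\<tau>: "filterlim (\<lambda>n. Suc (\<tau> n)) at_top sequentially"
      by (rule filterlim_compose[OF filterlim_Suc \<tau>])
    have "(\<lambda>n. f (D (\<tau> n) + h) + r (Suc (\<tau> n)) (D (\<tau> n) + h)) \<longlonglongrightarrow> f (x + h) + 0"
      by (intro tendsto_add f_tendsto r_tendsto Suc\<tau> D\<tau> tendsto_const S' D_in x)
    then show "(\<lambda>n. e (Suc (\<tau> n)) (D (\<tau> n) + h)) \<longlonglongrightarrow> f (x + h)" by (simp add: e_eq)
    have w0: "w \<longlonglongrightarrow> 0"
      using tendsto_real_sqrt[OF summable_LIMSEQ_zero[OF w(4)]] w_le by simp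
    \<comment> \<open>This bridges the index shift: the gradient belongs to
      \<open>F (Suc (\<tau> n))\<close>, while the known limit concerns
      \<open>F (\<tau> n)\<close>.\<close>
    have "(\<lambda>n. F (Suc (\<tau> n)) (D (\<tau> n)) - F (\<tau> n) (D (\<tau> n))) \<longlonglongrightarrow> 0"
    proof (rule Lim_null_comparison)
      show "\<forall>\<^sub>F n in sequentially. norm (F (Suc (\<tau> n)) (D (\<tau> n)) - F (\<tau> n) (D (\<tau> n))) \<le> 2 * B * w (\<tau> n)"
        using F_diff[OF D_S] by simp
      show "(\<lambda>n. 2 * B * w (\<tau> n)) \<longlonglongrightarrow> 0"
        by (intro tendsto_mult_right_zero filterlim_compose[OF w0 \<tau>])
    qed
    then have "(\<lambda>n. (F (Suc (\<tau> n)) (D (\<tau> n)) - F (\<tau> n) (D (\<tau> n))) - (f (D (\<tau> n)) - F (\<tau> n) (D (\<tau> n)))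
        + f (D (\<tau> n)) + gF (Suc (\<tau> n)) (D (\<tau> n)) \<bullet> h + B * (norm h)\<^sup>2)
        \<longlonglongrightarrow> 0 - 0 + f x + g \<bullet> h + B * (norm h)\<^sup>2"
      by (intro tendsto_add tendsto_diff tendsto_inner g tendsto_const f_tendsto D\<tau> D_S K_S x
          filterlim_compose[OF exp_sur_tendsto \<tau>])
    then show "(\<lambda>n. F (Suc (\<tau> n)) (D (\<tau> n)) + gF (Suc (\<tau> n)) (D (\<tau> n)) \<bullet> h + B * (norm h)\<^sup>2)
        \<longlonglongrightarrow> f x + g \<bullet> h + B * (norm h)\<^sup>2" by simp
    show "\<exists>N. \<forall>n\<ge>N. e (Suc (\<tau> n)) (D (\<tau> n) + h)
        \<le> F (Suc (\<tau> n)) (D (\<tau> n)) + gF (Suc (\<tau> n)) (D (\<tau> n)) \<bullet> h + B * (norm h)\<^sup>2"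
    proof (intro exI allI impI)
      fix n
      show "e (Suc (\<tau> n)) (D (\<tau> n) + h)
        \<le> F (Suc (\<tau> n)) (D (\<tau> n)) + gF (Suc (\<tau> n)) (D (\<tau> n)) \<bullet> h + B * (norm h)\<^sup>2"
        using e_le_F[OF S\<tau>[of n], of "Suc (\<tau> n)"]
          smooth_bound_descent[OF F_smooth[of "Suc (\<tau> n)"] S D_S[of "\<tau> n"] S\<tau>[of n]] by simp
    qed
  qed
  moreover have "g = G"
  proof -
    \<comment> \<open>By \<open>touch\<close> this difference has a local minimum at
      \<open>x\<close>, so its derivative \<open>g - G\<close> vanishes there.\<close>
    let ?d = "\<lambda>z. f x + g \<bullet> (z - x) + B * ((z - x) \<bullet> (z - x)) - f z"
    have "(?d has_derivative (\<lambda>h. g \<bullet> h - h \<bullet> G)) (at x)"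
      using G unfolding gderiv_def by (auto intro!: derivative_eq_intros)
    then have "(\<lambda>h. g \<bullet> h - h \<bullet> G) = (\<lambda>h. 0)"
    proof (rule differential_zero_maxmin[of x "ball x 1" ?d, rotated 2])
      show "(\<forall>z\<in>ball x 1. ?d z \<le> ?d x) \<or> (\<forall>z\<in>ball x 1. ?d x \<le> ?d z)"
      proof (intro disjI2 ballI)
        fix z assume "z \<in> ball x 1"
        then have "norm (z - x) \<le> 1" by (simp add: dist_norm norm_minus_commute)
        from touch[OF this] show "?d x \<le> ?d z" by (simp add: power2_norm_eq_inner)
      qed
    qed auto
    from fun_cong[OF this, of "g - G"] have "(g - G) \<bullet> (g - G) = 0"
      by (simp add: inner_diff_left inner_diff_right inner_commute)
    then show ?thesis by simp
  qed
  ultimately show ?thesis by (simp add: inner_diff_right)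
qed

end

section \<open>Occupation errors of a finite Markov chain\<close>

lemma mat_power_transition_matrix:
  assumes "transition_matrix P"
  shows "transition_matrix (mat_power P k)"
proof (induction k)
  case 0
  show ?case by (auto simp: transition_matrix_def mat_def)
next
  case (Suc k)
  have "(\<Sum>y\<in>UNIV. \<Sum>z\<in>UNIV. mat_power P k $ x $ z * P $ z $ y) = 1" for x
    using Suc assms by (subst sum.swap) (simp add: transition_matrix_def flip: sum_distrib_left)
  moreover have "0 \<le> mat_power P k $ x $ z" "0 \<le> P $ x $ z" for x z
    using Suc assms by (auto simp: transition_matrix_def)
  ultimately show ?case by (auto simp: transition_matrix_def matrix_matrix_mult_def intro!: sum_nonneg)
qed

text \<open>Maximum principle: at a maximal state \<open>z\<close> the average of \<open>v\<close>
  under any power of \<open>P\<close> equals the maximum, so every state reached with positive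
  weight is maximal too. Irreducibility reaches every state.\<close>

lemma harmonic_const:
  assumes P: "transition_matrix P" "irreducible_matrix P" and v: "P *v v = v"
  shows "v $ x = v $ y"
proof -
  have power: "mat_power P k *v v = v" for k
    by (induction k) (simp_all add: v matrix_vector_mul_assoc[symmetric])
  obtain z where z: "\<And>x. v $ x \<le> v $ z"
  proof -
    have "Max (range (($) v)) \<in> range (($) v)" by (rule Max_in) auto
    then obtain z where z: "Max (range (($) v)) = v $ z" by (rule imageE)
    have "v $ x \<le> Max (range (($) v))" for x by (rule Max_ge) auto
    then show ?thesis using that[of z] by (simp add: z)
  qed
  have "v $ x = v $ z" for x
  proof -
    obtain k where k: "0 < mat_power P k $ z $ x" using P(2) by (auto simp: irreducible_matrix_def)
    note T = mat_power_transition_matrix[OF P(1), of k, unfolded transition_matrix_def]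
    have "(\<Sum>x\<in>UNIV. mat_power P k $ z $ x * (v $ z - v $ x)) = v $ z - (mat_power P k *v v) $ z"
      using T by (simp add: right_diff_distrib sum_subtractf matrix_vector_mult_def flip: sum_distrib_right)
    also have "\<dots> = 0" by (simp add: power)
    finally have "mat_power P k $ z $ x * (v $ z - v $ x) = 0"
      using T z by (subst (asm) sum_nonneg_eq_0_iff) auto
    with k show ?thesis by simp
  qed
  then show ?thesis by metis
qed

text \<open>Adding the rank-one projection \<open>v \<mapsto> (\<pi> \<bullet> v) 1\<close> to \<open>id - P\<close> makes it invertible, so the
  Poisson equation is solvable without any mixing-time estimate.\<close>

lemma poisson_equation:
  fixes P :: "real^'s::finite^'s" and \<pi> :: "'s pmf"
  assumes P: "transition_matrix P" "irreducible_matrix P" and \<pi>: "stationary_distribution P \<pi>"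
  obtains u :: "real^'s" where "\<And>x. u $ x - (P *v u) $ x = of_bool (x = s) - pmf \<pi> s"
proof -
  define m where "m v = (\<Sum>x\<in>UNIV. pmf \<pi> x * v $ x)" for v :: "real^'s"
  define A where "A v = v - P *v v + m v *\<^sub>R 1" for v
  have total: "(\<Sum>x\<in>UNIV. pmf \<pi> x) = 1" by (rule sum_pmf_eq_1) auto
  have m_P: "m (P *v v) = m v" for v
  proof -
    have "m (P *v v) = (\<Sum>x\<in>UNIV. \<Sum>y\<in>UNIV. pmf \<pi> x * P $ x $ y * v $ y)"
      by (simp add: m_def matrix_vector_mult_def sum_distrib_left mult.assoc)
    also have "\<dots> = (\<Sum>y\<in>UNIV. (\<Sum>x\<in>UNIV. pmf \<pi> x * P $ x $ y) * v $ y)"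
      by (subst sum.swap) (simp add: sum_distrib_right)
    finally show ?thesis using \<pi> by (simp add: stationary_distribution_def m_def)
  qed
  have m_diff: "m (v - v') = m v - m v'" for v v'
    by (simp add: m_def sum_subtractf right_diff_distrib)
  have m_const: "m (v + c *\<^sub>R 1) = m v + c" for v c
    by (simp add: m_def distrib_left sum.distrib total flip: sum_distrib_right)
  have m_A: "m (A v) = m v" for v by (simp add: A_def m_const m_diff m_P)
  have "linear A"
  proof (rule linearI)
    fix v v' :: "real^'s" and c :: real
    have "m (v + v') = m v + m v'" by (simp add: m_def sum.distrib algebra_simps)
    then show "A (v + v') = A v + A v'"
      by (simp add: A_def matrix_vector_right_distrib algebra_simps)
    have "m (c *\<^sub>R v) = c * m v" by (simp add: m_def sum_distrib_left algebra_simps)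
    then show "A (c *\<^sub>R v) = c *\<^sub>R A v"
      by (simp add: A_def matrix_vector_mult_scaleR algebra_simps)
  qed
  \<comment> \<open>Applying the stationary mean gives \<open>m v = 0\<close>, so \<open>v\<close>
    is harmonic, hence constant, and the constant equals its mean.\<close>
  moreover have "v = 0" if "A v = 0" for v
  proof -
    have "m v = 0" using m_A[of v] that by (simp add: m_def)
    then have "P *v v = v" using that by (simp add: A_def)
    then have const: "v $ x = v $ y" for x y using harmonic_const[OF P] by blast
    have "v $ y = 0" for y
    proof -
      have "m v = (\<Sum>x\<in>UNIV. pmf \<pi> x * v $ y)" unfolding m_def
        by (intro sum.cong refl arg_cong2[where f = "(*)"] const)
      also have "\<dots> = v $ y" by (simp add: total flip: sum_distrib_right)
      finally show ?thesis using \<open>m v = 0\<close> by simp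
    qed
    then show ?thesis by (simp add: vec_eq_iff)
  qed
  ultimately have "surj A"
    by (intro linear_injective_imp_surjective) (auto simp: linear_injective_0)
  then obtain u where u: "A u = (\<chi> x. of_bool (x = s) - pmf \<pi> s)" by (metis surjD)
  \<comment> \<open>The right-hand side of the equation has stationary mean zero, so the rank-one
    correction drops out at \<open>u\<close>.\<close>
  have "m u = (\<Sum>x\<in>UNIV. pmf \<pi> x * (of_bool (x = s) - pmf \<pi> s))"
    using m_A[of u] unfolding u by (simp add: m_def)
  also have "\<dots> = 0" by (simp add: right_diff_distrib sum_subtractf total flip: sum_distrib_right)
  finally have "u $ x - (P *v u) $ x = of_bool (x = s) - pmf \<pi> s" for x
    using arg_cong[OF u, of "\<lambda>v. v $ x"] by (simp add: A_def)
  then show thesis by (rule that)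
qed

section \<open>The martingale part and its second moment\<close>

lemma markov_chain_measurable_state:
  assumes "markov_chain M P Y" "t \<ge> 1"
  shows "Y t \<in> measurable M (count_space UNIV)"
  using assms unfolding markov_chain_def by blast

lemma markov_chain_measurable:
  assumes "markov_chain M P Y" "t \<ge> 1"
  shows "(\<lambda>x. h (Y t x)) \<in> borel_measurable M"
  by (rule measurable_compose[OF markov_chain_measurable_state[OF assms]]) simp

text \<open>Orthogonality of the increment to every function of the past. Since \<open>Z\<close>
  sees only the times up to \<open>t\<close>, the integral is a finite sum over paths, and each
  summand vanishes by the multiplied-out Markov equation, so conditional expectations can be
  avoided.\<close>

lemma markov_chain_martingale_difference:
  fixes Y :: "nat \<Rightarrow> 'w \<Rightarrow> 's::finite"
  assumes "prob_space M" and Y: "markov_chain M P Y" and t: "t \<ge> 1"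
    and Z: "\<And>p p'. (\<And>j. j \<in> {1..t} \<Longrightarrow> p j = p' j) \<Longrightarrow> Z p = Z p'"
  shows "(\<integral>x. Z (\<lambda>j. Y j x) * (u $ Y (Suc t) x - (P *v u) $ Y t x) \<partial>M) = 0"
proof -
  interpret prob_space M by fact
  define A where "A p = {x \<in> space M. \<forall>j\<in>{1..t}. Y j x = p j}" for p
  define A' where "A' p y = {x \<in> space M. \<forall>j\<in>{1..Suc t}. Y j x = (p(Suc t := y)) j}" for p y
  \<comment> \<open>Extensional functions give one representative per path of length
    \<open>t\<close>, hence a finite index set.\<close>
  let ?\<Pi> = "{1..t} \<rightarrow>\<^sub>E (UNIV :: 's set)"
  let ?g = "\<lambda>p x. Z p * ((\<Sum>y\<in>UNIV. u $ y * indicator (A' p y) x) - (P *v u) $ p t * indicator (A p) x)"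
  have meas: "{x \<in> space M. \<forall>j\<in>{1..n}. Y j x = p j} \<in> sets M" for p n
  proof -
    have "{x \<in> space M. Y j x = p j} \<in> sets M" if "j \<in> {1..n}" for j
    proof -
      have "Y j -` {p j} \<inter> space M \<in> sets M"
        by (rule measurable_sets[OF markov_chain_measurable_state[OF Y]]) (use that in auto)
      then show ?thesis by (simp add: vimage_def Int_def conj_commute)
    qed
    then show ?thesis by (intro sets.sets_Collect_finite_All) auto
  qed
  have A: "A p \<in> sets M" "A' p y \<in> sets M" for p y unfolding A_def A'_def by (rule meas)+
  have markov: "measure M (A' p y) = measure M (A p) * P $ p t $ y" for p y
  proof -
    have "measure M (A' p y) = measure M {x \<in> space M. \<forall>j\<in>{1..t}. Y j x = (p(Suc t := y)) j}
        * P $ (p(Suc t := y)) t $ (p(Suc t := y)) (Suc t)"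
      using Y t unfolding markov_chain_def A'_def by blast
    also have "{x \<in> space M. \<forall>j\<in>{1..t}. Y j x = (p(Suc t := y)) j} = A p" by (auto simp: A_def)
    finally show ?thesis by simp
  qed
  have "Z (\<lambda>j. Y j x) * (u $ Y (Suc t) x - (P *v u) $ Y t x) = (\<Sum>p\<in>?\<Pi>. ?g p x)" if x: "x \<in> space M" for x
  proof -
    \<comment> \<open>The observed path; it indexes the only summand that can be nonzero at
      \<open>x\<close>.\<close>
    define p0 where "p0 = (\<lambda>j\<in>{1..t}. Y j x)"
    have p0: "p0 \<in> ?\<Pi>" by (simp add: p0_def)
    have "?g p x = (if p = p0 then Z (\<lambda>j. Y j x) * (u $ Y (Suc t) x - (P *v u) $ Y t x) else 0)"
      if p: "p \<in> ?\<Pi>" for p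
    proof (cases "p = p0")
      case True
      have "indicator (A' p y) x = (of_bool (Y (Suc t) x = y) :: real)" for y
        using x True by (auto simp: A'_def p0_def indicator_def)
      then have "(\<Sum>y\<in>UNIV. u $ y * indicator (A' p y) x) = u $ Y (Suc t) x" by simp
      moreover have "indicator (A p) x = (1::real)" using x True by (auto simp: A_def p0_def)
      moreover have "Z p = Z (\<lambda>j. Y j x)" by (rule Z) (simp add: True p0_def)
      moreover have "p t = Y t x" using t by (simp add: True p0_def)
      ultimately show ?thesis using True by simp
    next
      case False
      have "x \<notin> A p"
      proof
        assume "x \<in> A p"
        then have "p = p0" using p by (intro PiE_ext[OF p p0]) (auto simp: A_def p0_def)
        with False show False ..
      qed
      moreover have "A' p y \<subseteq> A p" for y by (auto simp: A_def A'_def)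
      ultimately have "indicator (A p) x = (0::real)" "\<And>y. indicator (A' p y) x = (0::real)"
        by (auto simp: indicator_def)
      then show ?thesis using False by simp
    qed
    then show ?thesis using p0 by (simp add: sum.delta finite_PiE)
  qed
  then have "(\<integral>x. Z (\<lambda>j. Y j x) * (u $ Y (Suc t) x - (P *v u) $ Y t x) \<partial>M) = (\<integral>x. (\<Sum>p\<in>?\<Pi>. ?g p x) \<partial>M)"
    by (intro Bochner_Integration.integral_cong) auto
  also have "\<dots> = (\<Sum>p\<in>?\<Pi>. \<integral>x. ?g p x \<partial>M)"
    using A by (intro Bochner_Integration.integral_sum integrable_mult_right Bochner_Integration.integrable_diff
        Bochner_Integration.integrable_sum) (auto intro!: integrable_real_indicator simp: emeasure_eq_measure)
  also have "\<dots> = 0"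
  proof (intro sum.neutral ballI)
    fix p
    have ind: "(\<integral>x. indicator B x \<partial>M) = measure M B" if "B \<in> sets M" for B using that by simp
    have int: "integrable M (\<lambda>x. k * indicator B x :: real)" if "B \<in> sets M" for k B
      using that by (auto intro!: integrable_mult_right integrable_real_indicator simp: emeasure_eq_measure)
    have "(\<integral>x. ?g p x \<partial>M) = Z p * ((\<Sum>y\<in>UNIV. u $ y * measure M (A' p y)) - (P *v u) $ p t * measure M (A p))"
      by (simp only: integral_mult_right_zero ind A int Bochner_Integration.integrable_sum
          Bochner_Integration.integral_diff Bochner_Integration.integral_sum)
    also have "\<dots> = 0"
      by (simp add: markov matrix_vector_mult_def sum_distrib_left sum_distrib_right algebra_simps)
    finally show "(\<integral>x. ?g p x \<partial>M) = 0" .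
  qed
  finally show ?thesis .
qed

text \<open>By the Poisson equation the centred visit count is a martingale plus a bounded boundary
  term. Orthogonal bounded increments give a second moment linear in \<open>t\<close>, hence a mean
  absolute value of order \<open>sqrt t\<close>.\<close>

lemma markov_chain_occupation_deviation:
  fixes Y :: "nat \<Rightarrow> 'w \<Rightarrow> 's::finite"
  assumes "prob_space M" and Y: "markov_chain M P Y" and P: "irreducible_matrix P"
    and \<pi>: "stationary_distribution P \<pi>"
  obtains C where "\<And>t. (\<integral>x. \<bar>\<Sum>j\<in>{1..t}. of_bool (Y j x = s) - pmf \<pi> s\<bar> \<partial>M) \<le> C * sqrt (real t)"
proof -
  interpret prob_space M by fact
  have "transition_matrix P" using Y by (simp add: markov_chain_def)
  then obtain u where u: "\<And>x. u $ x - (P *v u) $ x = of_bool (x = s) - pmf \<pi> s"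
    using poisson_equation P \<pi> by metis
  define d where "d j x = u $ Y (Suc j) x - (P *v u) $ Y j x" for j x
  define m where "m t x = (\<Sum>j\<in>{1..t}. d j x)" for t x
  \<comment> \<open>The factor 2 lets \<open>K\<close> bound differences of entries taken at two
    different states.\<close>
  define K where "K = (\<Sum>x\<in>UNIV. 2 * \<bar>u $ x\<bar> + 2 * \<bar>(P *v u) $ x\<bar>)"
  have K: "2 * \<bar>u $ x\<bar> + 2 * \<bar>(P *v u) $ x\<bar> \<le> K" for x
    unfolding K_def by (rule member_le_sum) auto
  have K0: "0 \<le> K" using K[of undefined] by linarith
  have u_K: "\<bar>u $ x - u $ y\<bar> \<le> K" for x y using K[of x] K[of y] by linarith
  have d_K: "\<bar>d j x\<bar> \<le> K" for j x unfolding d_def using K[of "Y (Suc j) x"] K[of "Y j x"] by linarith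
  have d_meas: "d j \<in> borel_measurable M" if "j \<ge> 1" for j
    unfolding d_def[abs_def] using markov_chain_measurable[OF Y] that
    by (intro borel_measurable_diff) auto
  have m_meas [measurable]: "m t \<in> borel_measurable M" for t
    unfolding m_def[abs_def] using d_meas by (intro borel_measurable_sum) auto
  have m_K: "\<bar>m t x\<bar> \<le> real t * K" for t x
  proof -
    have "(\<Sum>j\<in>{1..t}. \<bar>d j x\<bar>) \<le> of_nat (card {1..t}) * K"
      by (rule sum_bounded_above) (rule d_K)
    then show ?thesis unfolding m_def by (intro order_trans[OF sum_abs]) simp
  qed
  have int_m: "integrable M (m t)" for t
    by (rule integrable_const_bound[where B = "real t * K", OF AE_I2 m_meas]) (simp add: m_K)
  have m2_K: "(m t x)\<^sup>2 \<le> (real t * K)\<^sup>2" for t x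
    using power_mono[OF m_K[of t x], of 2] by simp
  have int_m2: "integrable M (\<lambda>x. (m t x)\<^sup>2)" for t
    by (rule integrable_const_bound[where B = "(real t * K)\<^sup>2", OF AE_I2]) (simp_all add: m2_K)
  have second_moment: "(\<integral>x. (m t x)\<^sup>2 \<partial>M) \<le> real t * K\<^sup>2" for t
  proof (induction t)
    case 0
    then show ?case by (simp add: m_def)
  next
    case (Suc t)
    have [measurable]: "d (Suc t) \<in> borel_measurable M" by (rule d_meas) simp
    have int_md: "integrable M (\<lambda>x. m t x * d (Suc t) x)"
    proof (rule integrable_const_bound[where B = "real t * K * K", OF AE_I2])
      show "norm (m t x * d (Suc t) x) \<le> real t * K * K" for x
        unfolding real_norm_def abs_mult using m_K[of t x] d_K[of "Suc t" x] K0 by (intro mult_mono) auto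
    qed simp
    have d2: "(d (Suc t) x)\<^sup>2 \<le> K\<^sup>2" for x
      using power_mono[OF d_K[of "Suc t" x], of 2] by simp
    have int_d2: "integrable M (\<lambda>x. (d (Suc t) x)\<^sup>2)"
      by (rule integrable_const_bound[where B = "K\<^sup>2", OF AE_I2]) (simp_all add: d2)
    \<comment> \<open>The sum \<open>m t\<close> as a function of the path uses the times
      \<open>1\<close> to \<open>Suc t\<close>, so the lemma is applied at time
      \<open>Suc t\<close>.\<close>
    have "(\<integral>x. (\<lambda>p. \<Sum>j\<in>{1..t}. u $ p (Suc j) - (P *v u) $ p j) (\<lambda>j. Y j x)
        * (u $ Y (Suc (Suc t)) x - (P *v u) $ Y (Suc t) x) \<partial>M) = 0"
      by (rule markov_chain_martingale_difference[OF \<open>prob_space M\<close> Y]) (auto intro!: sum.cong)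
    then have ortho: "(\<integral>x. m t x * d (Suc t) x \<partial>M) = 0" by (simp add: m_def d_def)
    have "(\<integral>x. (m (Suc t) x)\<^sup>2 \<partial>M) = (\<integral>x. (m t x)\<^sup>2 + 2 * (m t x * d (Suc t) x) + (d (Suc t) x)\<^sup>2 \<partial>M)"
      by (intro Bochner_Integration.integral_cong refl) (simp add: m_def power2_eq_square algebra_simps)
    also have "\<dots> = (\<integral>x. (m t x)\<^sup>2 \<partial>M) + 2 * (\<integral>x. m t x * d (Suc t) x \<partial>M) + (\<integral>x. (d (Suc t) x)\<^sup>2 \<partial>M)"
      using int_m2 int_md int_d2 by simp
    also have "\<dots> \<le> real t * K\<^sup>2 + 2 * 0 + K\<^sup>2"
      unfolding ortho using Suc integral_le_const[OF int_d2, of "K\<^sup>2"] d2 by (intro add_mono) auto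
    finally show ?case by (simp add: algebra_simps)
  qed
  \<comment> \<open>Integrates the pointwise bound
    \<open>\<bar>m\<bar> \<le> m\<^sup>2 / sqrt t + sqrt t\<close>, in place of the Cauchy-Schwarz
    inequality. The three summands of the constant belong to the boundary term, the second moment
    and the added \<open>sqrt t\<close>.\<close>
  have "(\<integral>x. \<bar>\<Sum>j\<in>{1..t}. of_bool (Y j x = s) - pmf \<pi> s\<bar> \<partial>M) \<le> (K + K\<^sup>2 + 1) * sqrt (real t)" for t
  proof (cases "t = 0")
    case False
    then have t: "1 \<le> sqrt (real t)" by simp
    have N: "(\<Sum>j\<in>{1..t}. of_bool (Y j x = s) - pmf \<pi> s) = m t x + (u $ Y 1 x - u $ Y (Suc t) x)" for x
    proof -
      have "m t x = (\<Sum>j\<in>{1..t}. (of_bool (Y j x = s) - pmf \<pi> s) + (u $ Y (Suc j) x - u $ Y j x))"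
        unfolding m_def d_def by (intro sum.cong refl) (simp flip: u)
      also have "\<dots> = (\<Sum>j\<in>{1..t}. of_bool (Y j x = s) - pmf \<pi> s) + (\<Sum>j\<in>{1..t}. u $ Y (Suc j) x - u $ Y j x)"
        by (rule sum.distrib)
      also have "(\<Sum>j\<in>{1..t}. u $ Y (Suc j) x - u $ Y j x) = u $ Y (Suc t) x - u $ Y 1 x"
        by (rule sum_Suc_diff) simp
      finally show ?thesis by simp
    qed
    have "(\<integral>x. \<bar>\<Sum>j\<in>{1..t}. of_bool (Y j x = s) - pmf \<pi> s\<bar> \<partial>M)
        \<le> (\<integral>x. (m t x)\<^sup>2 / sqrt (real t) + (sqrt (real t) + K) \<partial>M)"
    proof (rule integral_mono)
      show "integrable M (\<lambda>x. (m t x)\<^sup>2 / sqrt (real t) + (sqrt (real t) + K))" using int_m2 by simp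
      show "integrable M (\<lambda>x. \<bar>\<Sum>j\<in>{1..t}. of_bool (Y j x = s) - pmf \<pi> s\<bar>)"
        unfolding N using markov_chain_measurable[OF Y] False
        by (intro integrable_abs Bochner_Integration.integrable_add int_m
            integrable_const_bound[where B = K] AE_I2 borel_measurable_diff) (auto simp: u_K)
      fix x
      have "2 * \<bar>m t x\<bar> * sqrt (real t) \<le> (m t x)\<^sup>2 + sqrt (real t) * sqrt (real t)"
        using sum_squares_bound[of "\<bar>m t x\<bar>" "sqrt (real t)"] by simp
      moreover have "0 \<le> \<bar>m t x\<bar> * sqrt (real t)" by simp
      ultimately have "\<bar>m t x\<bar> * sqrt (real t) \<le> (m t x)\<^sup>2 + sqrt (real t) * sqrt (real t)"
        by linarith
      then have "\<bar>m t x\<bar> \<le> ((m t x)\<^sup>2 + sqrt (real t) * sqrt (real t)) / sqrt (real t)"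
        using t by (simp only: pos_le_divide_eq[OF less_le_trans[OF zero_less_one]])
      then have "\<bar>m t x\<bar> \<le> (m t x)\<^sup>2 / sqrt (real t) + sqrt (real t)"
        using t by (simp only: add_divide_distrib) (simp add: real_div_sqrt)
      then show "\<bar>\<Sum>j\<in>{1..t}. of_bool (Y j x = s) - pmf \<pi> s\<bar> \<le> (m t x)\<^sup>2 / sqrt (real t) + (sqrt (real t) + K)"
        unfolding N using u_K[of "Y 1 x" "Y (Suc t) x"] by linarith
    qed
    also have "\<dots> = (\<integral>x. (m t x)\<^sup>2 \<partial>M) / sqrt (real t) + (sqrt (real t) + K)"
      using int_m2 by (simp add: prob_space)
    also have "\<dots> \<le> (real t * K\<^sup>2) / sqrt (real t) + (sqrt (real t) + K * sqrt (real t))"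
      using second_moment[of t] t K0 mult_left_mono[OF t K0] by (intro add_mono divide_right_mono) auto
    also have "(real t * K\<^sup>2) / sqrt (real t) = K\<^sup>2 * sqrt (real t)"
      by (metis mult.commute real_div_sqrt of_nat_0_le_iff times_divide_eq_right)
    finally show ?thesis by (simp add: algebra_simps)
  qed simp
  then show thesis by (rule that)
qed

section \<open>From mean deviations to almost sure summability\<close>

text \<open>Exchanging sum and integral of nonnegative functions shows that the total sum has finite
  integral, so it is finite almost everywhere.\<close>

lemma (in finite_measure) AE_summable_of_integral_le:
  fixes g :: "nat \<Rightarrow> 'a \<Rightarrow> real"
  assumes g: "\<And>n. integrable M (g n)" "\<And>n x. 0 \<le> g n x"
    and le: "\<And>n. (\<integral>x. g n x \<partial>M) \<le> a n" and a: "summable a"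
  shows "AE x in M. summable (\<lambda>n. g n x)"
proof -
  have a0: "0 \<le> a n" for n using le[of n] Bochner_Integration.integral_nonneg[of M "g n"] g(2) by (meson order_trans)
  have "(\<integral>\<^sup>+x. (\<Sum>n. ennreal (g n x)) \<partial>M) = (\<Sum>n. \<integral>\<^sup>+x. ennreal (g n x) \<partial>M)"
    using g by (intro nn_integral_suminf) (auto intro: borel_measurable_integrable)
  also have "\<dots> \<le> (\<Sum>n. ennreal (a n))"
    using g le by (intro suminf_le) (auto simp: nn_integral_eq_integral intro: ennreal_leI)
  also have "\<dots> < \<infinity>" using suminf_ennreal2[OF a0 a] by simp
  finally have "AE x in M. (\<Sum>n. ennreal (g n x)) \<noteq> \<infinity>"
    using g by (intro nn_integral_PInf_AE) (auto intro: borel_measurable_integrable)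
  then show ?thesis
  proof eventually_elim
    case (elim x)
    then show ?case using g(2) by (intro summable_suminf_not_top) auto
  qed
qed

text \<open>The error \<open>q t\<close> is compared with \<open>w t * n t\<close>, where
  \<open>n t\<close> is the centred visit count. In the recursion for the difference
  \<open>z\<close> the new observation cancels, leaving a contraction driven by
  \<open>w t * w (Suc t) * n t\<close>.\<close>

lemma occupation_error_summable:
  fixes w :: "nat \<Rightarrow> real"
  assumes w: "\<And>t. t \<ge> 1 \<Longrightarrow> 0 < w t \<and> w t \<le> 1" "\<And>t. t \<ge> 1 \<Longrightarrow> w (Suc t) \<le> w t"
    and slow: "\<forall>\<^sub>F t in sequentially. inverse (w (Suc t)) - inverse (w t) \<le> 1"
    and N: "summable (\<lambda>t. w t * w (Suc t) * \<bar>\<Sum>j\<in>{1..t}. of_bool (y j = s) - p s\<bar>)"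
  shows "summable (\<lambda>t. w (Suc t) * \<bar>occupation_error (\<lambda>t. w (Suc t)) p (\<lambda>t. y (Suc t)) t s\<bar>)"
proof -
  define n where "n t = (\<Sum>j\<in>{1..t}. of_bool (y j = s) - p s)" for t
  define q where "q t = occupation_error (\<lambda>t. w (Suc t)) p (\<lambda>t. y (Suc t)) t s" for t
  define z where "z t = q t - w t * n t" for t
  have N: "summable (\<lambda>t. w t * w (Suc t) * \<bar>n t\<bar>)" using N by (simp add: n_def)
  have wS: "0 < w (Suc t)" "w (Suc t) \<le> 1" for t using w(1)[of "Suc t"] by auto
  obtain m where m: "\<And>t. t \<ge> m \<Longrightarrow> inverse (w (Suc t)) - inverse (w t) \<le> 1"
    using slow by (auto simp: eventually_sequentially)
  have z_step: "\<bar>z (Suc t)\<bar> \<le> (1 - w (Suc t)) * \<bar>z t\<bar> + w t * w (Suc t) * \<bar>n t\<bar>"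
    if t: "t \<ge> max 1 m" for t
  proof -
    have wt: "0 < w t" "w (Suc t) \<le> w t" "inverse (w (Suc t)) - inverse (w t) \<le> 1" using w m t by auto
    have "(inverse (w (Suc t)) - inverse (w t)) * (w t * w (Suc t)) \<le> 1 * (w t * w (Suc t))"
      using wt wS[of t] by (intro mult_right_mono) auto
    then have "w t - w (Suc t) \<le> w t * w (Suc t)" using wt wS[of t] by (simp add: field_simps)
    \<comment> \<open>The condition on the inverse weights puts the coefficient below zero,
      monotonicity keeps it above \<open>- w t * w (Suc t)\<close>.\<close>
    then have coeff: "\<bar>w t - w (Suc t) - w t * w (Suc t)\<bar> \<le> w t * w (Suc t)" using wt by linarith
    have "z (Suc t) = (1 - w (Suc t)) * z t + (w t - w (Suc t) - w t * w (Suc t)) * n t"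
      unfolding z_def by (simp add: q_def n_def algebra_simps)
    also have "\<bar>\<dots>\<bar> \<le> \<bar>(1 - w (Suc t)) * z t\<bar> + \<bar>(w t - w (Suc t) - w t * w (Suc t)) * n t\<bar>"
      by (rule abs_triangle_ineq)
    also have "\<dots> \<le> (1 - w (Suc t)) * \<bar>z t\<bar> + w t * w (Suc t) * \<bar>n t\<bar>"
      using coeff wS[of t] by (intro add_mono) (auto simp: abs_mult intro!: mult_right_mono)
    finally show ?thesis .
  qed
  have "summable (\<lambda>t. w (Suc t) * \<bar>z t\<bar>)"
  proof (rule summable_of_le_diff[OF _ _ N])
    show "0 \<le> w (Suc t) * \<bar>z t\<bar>" for t using wS[of t] by simp
    show "w (Suc t) * \<bar>z t\<bar> \<le> \<bar>z t\<bar> - \<bar>z (Suc t)\<bar> + w t * w (Suc t) * \<bar>n t\<bar>" if "t \<ge> max 1 m" for t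
      using z_step[OF that] by (simp add: algebra_simps)
    show "0 \<le> \<bar>z t\<bar>" for t by simp
  qed
  from summable_add[OF this N] show ?thesis unfolding q_def[symmetric]
  \<comment> \<open>The comparison starts at 1 because nothing is known about
    \<open>w 0\<close>.\<close>
  proof (rule summable_comparison_test'[where N = 1])
    fix t :: nat assume "1 \<le> t"
    then have "0 < w t" using w by auto
    then have "\<bar>q t\<bar> \<le> \<bar>z t\<bar> + w t * \<bar>n t\<bar>"
      using abs_triangle_ineq[of "z t" "w t * n t"] by (simp add: z_def abs_mult)
    from mult_left_mono[OF this, of "w (Suc t)"] wS[of t]
    show "norm (w (Suc t) * \<bar>q t\<bar>) \<le> w (Suc t) * \<bar>z t\<bar> + w t * w (Suc t) * \<bar>n t\<bar>"
      by (simp add: abs_mult algebra_simps)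
  qed
qed

text \<open>The mean of each term is at most a constant times \<open>(w t)\<^sup>2 * sqrt t\<close>,
  which is exactly the summable quantity of the weight assumption.\<close>

lemma markov_chain_occupation_error_summable:
  fixes Y :: "nat \<Rightarrow> 'w \<Rightarrow> 's::finite" and w :: "nat \<Rightarrow> real"
  assumes "prob_space M" and Y: "markov_chain M P Y" and P: "irreducible_matrix P"
    and \<pi>: "stationary_distribution P \<pi>"
    and w: "\<And>t. t \<ge> 1 \<Longrightarrow> 0 < w t \<and> w t \<le> 1" "\<And>t. t \<ge> 1 \<Longrightarrow> w (Suc t) \<le> w t"
    and w2: "summable (\<lambda>t. (w (Suc t))\<^sup>2 * sqrt (real (Suc t)))"
    and slow: "\<forall>\<^sub>F t in sequentially. inverse (w (Suc t)) - inverse (w t) \<le> 1"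
  shows "AE x in M. \<forall>s. summable (\<lambda>t. w (Suc t) *
    \<bar>occupation_error (\<lambda>t. w (Suc t)) (pmf \<pi>) (\<lambda>t. Y (Suc t) x) t s\<bar>)"
proof -
  interpret prob_space M by fact
  have "AE x in M. summable (\<lambda>t. w t * w (Suc t) * \<bar>\<Sum>j\<in>{1..t}. of_bool (Y j x = s) - pmf \<pi> s\<bar>)" for s
  proof -
    obtain C where C: "\<And>t. (\<integral>x. \<bar>\<Sum>j\<in>{1..t}. of_bool (Y j x = s) - pmf \<pi> s\<bar> \<partial>M) \<le> C * sqrt (real t)"
      using markov_chain_occupation_deviation[OF \<open>prob_space M\<close> Y P \<pi>] by blast
    have "summable (\<lambda>t. (w t)\<^sup>2 * sqrt (real t))"
      using w2 summable_Suc_iff[of "\<lambda>t. (w t)\<^sup>2 * sqrt (real t)"] by simp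
    then have "summable (\<lambda>t. (w t)\<^sup>2 * sqrt (real t) * C)" by (rule summable_mult2)
    then show ?thesis
    proof (rule AE_summable_of_integral_le[rotated 3])
      fix t
      show "0 \<le> w t * w (Suc t) * \<bar>\<Sum>j\<in>{1..t}. of_bool (Y j x = s) - pmf \<pi> s\<bar>" for x
        using w(1)[of t] w(1)[of "Suc t"] by (cases "t = 0") auto
      let ?N = "\<lambda>x. \<bar>\<Sum>j\<in>{1..t}. of_bool (Y j x = s) - pmf \<pi> s\<bar>"
      have "?N x \<le> real t * 1" for x
      proof -
        have "\<bar>of_bool (Y j x = s) - pmf \<pi> s\<bar> \<le> 1" for j
          using pmf_nonneg[of \<pi> s] pmf_le_1[of \<pi> s] by (cases "Y j x = s") auto
        then show ?thesis
          using order_trans[OF sum_abs sum_bounded_above[of "{1..t}" _ 1]] by force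
      qed
      then have "integrable M ?N"
        by (intro integrable_const_bound[where B = "real t * 1"] AE_I2 borel_measurable_abs
            borel_measurable_sum markov_chain_measurable[OF Y]) auto
      then show "integrable M (\<lambda>x. w t * w (Suc t) * ?N x)" by simp
      have "w t * w (Suc t) * (\<integral>x. ?N x \<partial>M) \<le> (w t)\<^sup>2 * (C * sqrt (real t))"
      \<comment> \<open>At \<open>t = 0\<close> the weight is arbitrary, but the empty sum makes the
        term vanish.\<close>
      proof (cases "t = 0")
        case False
        then show ?thesis using w(1)[of t] w(1)[of "Suc t"] w(2)[of t] C[of t]
          by (intro mult_mono) (auto simp: power2_eq_square intro!: Bochner_Integration.integral_nonneg)
      qed simp
      then show "(\<integral>x. w t * w (Suc t) * ?N x \<partial>M) \<le> (w t)\<^sup>2 * sqrt (real t) * C"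
        by (simp add: mult_ac)
    qed
  qed
  then have "AE x in M. \<forall>s. summable (\<lambda>t. w t * w (Suc t) * \<bar>\<Sum>j\<in>{1..t}. of_bool (Y j x = s) - pmf \<pi> s\<bar>)"
    by (simp add: AE_all_countable)
  then show ?thesis
  proof eventually_elim
    case (elim x)
    show ?case
    proof
      fix s
      show "summable (\<lambda>t. w (Suc t) * \<bar>occupation_error (\<lambda>t. w (Suc t)) (pmf \<pi>) (\<lambda>t. Y (Suc t) x) t s\<bar>)"
        by (rule occupation_error_summable[where w = w and p = "pmf \<pi>" and y = "\<lambda>j. Y j x", OF w slow])
          (use elim in auto)
    qed
  qed
qed

section \<open>Online CP-dictionary learning\<close>

lemma sum_telescope_linorder:
  fixes h :: "'n::{finite,linorder} set \<Rightarrow> real"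
  shows "(\<Sum>i\<in>UNIV. h {..i} - h {..<i}) = h UNIV - h {}"
proof -
  \<comment> \<open>Generalized to initial segments, so that induction can add a new maximum
    \<open>m\<close> with \<open>{..<m} = A\<close>.\<close>
  have "(\<forall>i\<in>A. \<forall>j<i. j \<in> A) \<Longrightarrow> (\<Sum>i\<in>A. h {..i} - h {..<i}) = h A - h {}" if "finite A" for A :: "'n set"
    using that
  proof (induction A rule: finite_linorder_max_induct)
    case (insert m A)
    have "{..<m} = A" "{..m} = insert m A" "\<forall>i\<in>A. \<forall>j<i. j \<in> A"
      using insert.hyps insert.prems by (auto simp: less_imp_neq le_less)
    moreover have "m \<notin> A" using insert.hyps by blast
    ultimately show ?case using insert.IH insert.hyps by simp
  qed simp
  then show ?thesis by simp
qed

lemma norm_vec_le_sum: "norm (x :: 'a::real_normed_vector^'n::finite) \<le> (\<Sum>i\<in>UNIV. norm (x $ i))"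
  unfolding norm_vec_def by (rule L2_set_le_sum) simp

text \<open>Each block update is compared with a Frank--Wolfe step of length \<open>\<alpha>\<close> towards \<open>V\<close>, which is
  feasible because \<open>\<alpha> * R \<le> \<delta>\<close>.\<close>

lemma block_coordinate_descent:
  fixes F :: "'a::real_inner^'n::{finite,linorder} \<Rightarrow> real"
  assumes F: "smooth_bound S B F g" and S: "convex S" "{D. \<forall>i. D $ i \<in> C i} \<subseteq> S"
    and C: "\<And>i. convex (C i)" "\<And>i U V. U \<in> C i \<Longrightarrow> V \<in> C i \<Longrightarrow> norm (U - V) \<le> R"
    and D: "\<And>i. D $ i \<in> C i" and E: "\<And>i. E $ i \<in> C i" and V: "\<And>i. V $ i \<in> C i"
    and step: "\<And>i. norm (E $ i - D $ i) \<le> \<delta>"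
    and min: "\<And>i U. U \<in> C i \<Longrightarrow> norm (U - D $ i) \<le> \<delta> \<Longrightarrow>
      F (\<chi> j. if j < i then E $ j else if j = i then E $ i else D $ j)
      \<le> F (\<chi> j. if j < i then E $ j else if j = i then U else D $ j)"
    and \<alpha>: "0 \<le> \<alpha>" "\<alpha> \<le> 1" "\<alpha> * R \<le> \<delta>"
  shows "F E \<le> F D + \<alpha> * (g D \<bullet> (V - D))
    + real CARD('n) * (\<alpha> * B * real CARD('n) * \<delta> * R + B * (\<alpha> * R)\<^sup>2)"
proof -
  \<comment> \<open>The tuple after the blocks in \<open>A\<close> have been replaced:
    \<open>X {..<i}\<close> precedes and \<open>X {..i}\<close> follows the update of block
    \<open>i\<close>.\<close>
  define X where "X A = (\<chi> j. if j \<in> A then E $ j else D $ j)" for A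
  define err where "err = \<alpha> * B * real CARD('n) * \<delta> * R + B * (\<alpha> * R)\<^sup>2"
  have in_S: "Z \<in> S" if "\<And>i. Z $ i \<in> C i" for Z using S(2) that by blast
  have X_S: "X A \<in> S" for A by (rule in_S) (simp add: X_def D E)
  have D_S: "D \<in> S" by (rule in_S) (rule D)
  have B: "0 \<le> B" using smooth_boundD(1)[OF F D_S] by linarith
  have \<delta>: "0 \<le> \<delta>" using step[of undefined] norm_ge_zero by (rule order_trans[rotated])
  have XD: "norm (X A - D) \<le> real CARD('n) * \<delta>" for A
  proof -
    have "norm (X A - D) \<le> (\<Sum>i\<in>UNIV. norm ((X A - D) $ i))" by (rule norm_vec_le_sum)
    also have "\<dots> \<le> (\<Sum>i\<in>(UNIV::'n set). \<delta>)" using step \<delta> by (intro sum_mono) (simp add: X_def)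
    finally show ?thesis by simp
  qed
  have block: "F (X {..i}) - F (X {..<i}) \<le> \<alpha> * (g D $ i \<bullet> (V $ i - D $ i)) + err" for i
  proof -
    define d where "d = V $ i - D $ i"
    define W where "W = X {..<i} + axis i (\<alpha> *\<^sub>R d)"
    have d: "norm d \<le> R" unfolding d_def by (rule C(2)[OF V D])
    have Ui: "D $ i + \<alpha> *\<^sub>R d \<in> C i"
      using convexD_alt[OF C(1) D V \<alpha>(1,2), of i] by (simp add: d_def algebra_simps)
    have W_eq: "W = (\<chi> j. if j < i then E $ j else if j = i then D $ i + \<alpha> *\<^sub>R d else D $ j)"
      by (simp add: W_def X_def vec_eq_iff axis_def)
    have W_S: "W \<in> S" by (rule in_S) (simp add: W_eq D E Ui)
    have "norm (\<alpha> *\<^sub>R d) \<le> \<delta>" using mult_left_mono[OF d \<alpha>(1)] \<alpha>(1,3) by simp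
    then have "F (\<chi> j. if j < i then E $ j else if j = i then E $ i else D $ j) \<le> F W"
      unfolding W_eq by (intro min Ui) simp
    also have "(\<chi> j. if j < i then E $ j else if j = i then E $ i else D $ j) = X {..i}"
      by (simp add: X_def vec_eq_iff less_imp_le)
    finally have "F (X {..i}) \<le> F W" .
    moreover have "F W \<le> F (X {..<i}) + \<alpha> * (g (X {..<i}) $ i \<bullet> d) + B * (norm (\<alpha> *\<^sub>R d))\<^sup>2"
      using smooth_bound_descent[OF F S(1) X_S W_S, of "{..<i}"]
      by (simp add: W_def inner_axis power2_norm_eq_inner power_mult_distrib power2_eq_square[of \<alpha>])
    moreover have "B * (norm (\<alpha> *\<^sub>R d))\<^sup>2 \<le> B * (\<alpha> * R)\<^sup>2"
      using mult_left_mono[OF d \<alpha>(1)] \<alpha>(1) B by (intro mult_left_mono power_mono) auto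
    \<comment> \<open>Passing from the partially updated tuple to \<open>D\<close> makes all blocks
      refer to the same gradient; the two tuples are at most \<open>real CARD('n) * \<delta>\<close>
      apart.\<close>
    moreover have "g (X {..<i}) $ i \<bullet> d \<le> g D $ i \<bullet> d + B * real CARD('n) * \<delta> * R"
    proof -
      have "(g (X {..<i}) - g D) $ i \<bullet> d \<le> norm ((g (X {..<i}) - g D) $ i) * norm d"
        by (rule norm_cauchy_schwarz)
      also have "\<dots> \<le> (B * (real CARD('n) * \<delta>)) * R"
      proof (rule mult_mono)
        have "norm ((g (X {..<i}) - g D) $ i) \<le> norm (g (X {..<i}) - g D)"
          by (rule Finite_Cartesian_Product.norm_nth_le)
        also have "\<dots> \<le> B * norm (X {..<i} - D)" by (rule smooth_boundD(4)[OF F X_S D_S])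
        also have "\<dots> \<le> B * (real CARD('n) * \<delta>)" using XD B by (rule mult_left_mono)
        finally show "norm ((g (X {..<i}) - g D) $ i) \<le> B * (real CARD('n) * \<delta>)" .
      qed (use d B \<delta> in auto)
      finally show ?thesis by (simp add: inner_diff_left mult.assoc)
    qed
    from mult_left_mono[OF this \<alpha>(1)]
    have "\<alpha> * (g (X {..<i}) $ i \<bullet> d) \<le> \<alpha> * (g D $ i \<bullet> d) + \<alpha> * B * real CARD('n) * \<delta> * R"
      by (simp add: algebra_simps)
    ultimately show ?thesis unfolding err_def d_def[symmetric] by linarith
  qed
  have "F (X UNIV) - F (X {}) = (\<Sum>i\<in>UNIV. F (X {..i}) - F (X {..<i}))"
    using sum_telescope_linorder[of "\<lambda>A. F (X A)"] by simp
  also have "\<dots> \<le> (\<Sum>i\<in>UNIV. \<alpha> * (g D $ i \<bullet> (V $ i - D $ i)) + err)"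
    by (intro sum_mono block)
  also have "\<dots> = \<alpha> * (g D \<bullet> (V - D)) + real CARD('n) * err"
    by (simp add: sum.distrib inner_vec_def flip: sum_distrib_left)
  finally show ?thesis by (simp add: X_def err_def)
qed

text \<open>An infimum of functions with a common bound and Lipschitz constant inherits both,
  although it need not be differentiable. This is all the locale asks of the loss.\<close>

lemma INF_smooth_bound:
  assumes k: "\<And>H. H \<in> A \<Longrightarrow> \<exists>g. smooth_bound S B (\<lambda>x. k x H) g" and A: "A \<noteq> {}" and S: "convex S" "x \<in> S"
  shows "\<bar>INF H\<in>A. k x H\<bar> \<le> B" "x' \<in> S \<Longrightarrow> \<bar>(INF H\<in>A. k x H) - (INF H\<in>A. k x' H)\<bar> \<le> B * norm (x - x')"
    and "H \<in> A \<Longrightarrow> (INF H\<in>A. k x H) \<le> k x H"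
proof -
  have bound: "\<bar>k z H\<bar> \<le> B" if "z \<in> S" "H \<in> A" for z H
    using k[OF that(2)] smooth_boundD(1) that(1) by blast
  have bdd: "bdd_below (k z ` A)" if "z \<in> S" for z
    using bound[OF that] by (intro bdd_belowI2[of _ "- B"]) (force simp: abs_le_iff)
  show lower: "H \<in> A \<Longrightarrow> (INF H\<in>A. k x H) \<le> k x H" for H by (rule cINF_lower[OF bdd[OF S(2)]])
  have "- B \<le> (INF H\<in>A. k x H)" using bound[OF S(2)] A by (intro cINF_greatest) (force simp: abs_le_iff)+
  moreover have "(INF H\<in>A. k x H) \<le> B" using A lower bound[OF S(2)] by (meson abs_le_D1 all_not_in_conv order_trans)
  ultimately show "\<bar>INF H\<in>A. k x H\<bar> \<le> B" by (simp add: abs_le_iff)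
  have half: "(INF H\<in>A. k z H) - B * norm (z - z') \<le> (INF H\<in>A. k z' H)" if z: "z \<in> S" "z' \<in> S" for z z'
  proof (rule cINF_greatest[OF A])
    fix H assume H: "H \<in> A"
    obtain g where "smooth_bound S B (\<lambda>x. k x H) g" using k[OF H] by blast
    from smooth_bound_lipschitz[OF this S(1) z] cINF_lower[OF bdd[OF z(1)] H]
    show "(INF H\<in>A. k z H) - B * norm (z - z') \<le> k z' H" by linarith
  qed
  show "\<bar>(INF H\<in>A. k x H) - (INF H\<in>A. k x' H)\<bar> \<le> B * norm (x - x')" if "x' \<in> S"
    using half[OF S(2) that] half[OF that S(2)] by (simp add: norm_minus_commute abs_le_iff)
qed

section \<open>The algorithm on a fixed path\<close>

lemma compact_dict_set:
  assumes "\<And>i. compact (C i)"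
  shows "compact (dict_set C)"
proof -
  have "closed (dict_set C)"
  proof -
    have "closed ((\<lambda>D. D $ i) -` C i)" for i
      using assms by (intro closed_vimage compact_imp_closed continuous_intros)
    then have "closed (\<Inter>i. (\<lambda>D. D $ i) -` C i)" by blast
    then show ?thesis by (simp add: dict_set_def vimage_def INTER_eq)
  qed
  moreover have "bounded (dict_set C)"
  proof -
    have "\<exists>R. \<forall>U\<in>C i. norm U \<le> R" for i using compact_imp_bounded[OF assms[of i]] by (simp add: bounded_iff)
    then obtain R where R: "\<And>i U. U \<in> C i \<Longrightarrow> norm U \<le> R i" by metis
    have "norm D \<le> (\<Sum>i\<in>UNIV. R i)" if "D \<in> dict_set C" for D
    proof -
      have "norm D \<le> (\<Sum>i\<in>UNIV. norm (D $ i))" by (rule norm_vec_le_sum)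
      also have "\<dots> \<le> (\<Sum>i\<in>UNIV. R i)" using R that by (intro sum_mono) (simp add: dict_set_def)
      finally show ?thesis .
    qed
    then show ?thesis by (auto simp: bounded_iff)
  qed
  ultimately show ?thesis by (simp add: compact_eq_bounded_closed)
qed

text \<open>Instantiates the descent locale with a ball as \<open>S\<close> and the dictionary set
  as \<open>K\<close>. Limit point stationarity becomes convergence of the distance by
  compactness.\<close>

lemma ocpdl_pathwise:
  fixes \<phi> :: "'s::finite \<Rightarrow> ('n::{finite,linorder}, 'k::finite, 'b::finite) tensor"
    and C :: "'n \<Rightarrow> (real^'r::finite^'k) set" and Ccode :: "(real^'b^'r) set"
  assumes c: "c > 0"
    and C: "\<And>i. compact (C i)" "\<And>i. convex (C i)"
    and w: "\<And>t. t \<ge> 1 \<Longrightarrow> 0 < w t \<and> w t \<le> 1" "\<And>t. t \<ge> 1 \<Longrightarrow> w (Suc t) \<le> w t"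
      "\<not> summable (\<lambda>t. w (Suc t))" "summable (\<lambda>t. (w (Suc t))\<^sup>2)"
    and out: "ocpdl_output lam I C Ccode w c (\<lambda>t. \<phi> (y t)) H D"
    and q: "\<And>s. summable (\<lambda>t. w (Suc t) * \<bar>occupation_error (\<lambda>t. w (Suc t)) (pmf \<pi>) (\<lambda>t. y (Suc t)) t s\<bar>)"
    and \<rho>: "\<And>D. D \<in> dict_set C \<Longrightarrow> norm D + 1 \<le> \<rho>"
    and smooth: "\<And>s V. V \<in> Ccode \<Longrightarrow>
      \<exists>g. smooth_bound (cball 0 \<rho>) B (\<lambda>D :: ('n, 'k, 'r) mat_tuple. code_loss lam I (\<phi> s) D V) g"
  defines "F \<equiv> sur_loss lam I w (\<lambda>t. \<phi> (y t)) H" and "e \<equiv> emp_loss lam I Ccode w (\<lambda>t. \<phi> (y t))"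
    and "expf \<equiv> exp_loss lam I Ccode \<pi> \<phi>"
  shows "convergent (\<lambda>t. F t (D t)) \<and> (\<lambda>t. e t (D t) - F t (D t)) \<longlonglongrightarrow> 0 \<and> (\<lambda>t. expf (D t) - F t (D t)) \<longlonglongrightarrow> 0
    \<and> (\<forall>t. \<bar>F t (D t)\<bar> \<le> B \<and> \<bar>e t (D t)\<bar> \<le> B)
    \<and> (C1_Lipschitz_gradient_on expf (dict_set C) \<longrightarrow>
        (\<lambda>t. block_setdist (D t) {E. stationary_point expf (dict_set C) E}) \<longlonglongrightarrow> 0)"
proof -
  let ?S = "cball 0 \<rho> :: ('n, 'k, 'r) mat_tuple set"
  let ?K = "dict_set C"
  note code = out[unfolded ocpdl_output_def, THEN conjunct2, rule_format, THEN conjunct1, unfolded is_arg_min_def]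
  note block = out[unfolded ocpdl_output_def, THEN conjunct2, rule_format, THEN conjunct2, rule_format,
      unfolded is_arg_min_def]
  have H_in: "H (Suc t) \<in> Ccode" for t using code by blast
  have H_min: "code_loss lam I (\<phi> (y (Suc t))) (D t) (H (Suc t)) \<le> code_loss lam I (\<phi> (y (Suc t))) (D t) V"
    if "V \<in> Ccode" for t V using code that not_le by blast
  have D_step: "norm (D (Suc t) $ i - D t $ i) \<le> c * w (Suc t)" for t i using block by blast
  have D_in: "D t \<in> ?K" for t
  proof (cases t)
    case 0
    then show ?thesis using out by (simp add: ocpdl_output_def)
  next
    case (Suc u)
    then show ?thesis using block by (simp add: dict_set_def)
  qed
  have D_C: "D t $ i \<in> C i" for t i using D_in by (simp add: dict_set_def)
  have K_compact: "compact ?K" by (rule compact_dict_set[OF C(1)])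
  have K_S: "?K \<subseteq> ?S" using \<rho> by force
  have D_S: "D t \<in> ?S" for t using D_in K_S by blast
  have wS: "0 < w (Suc t)" "w (Suc t) \<le> 1" for t using w(1)[of "Suc t"] by auto
  have code_ne: "Ccode \<noteq> {}" using H_in by blast
  have "\<forall>t. \<exists>g. smooth_bound ?S B (\<lambda>D. code_loss lam I (\<phi> (y (Suc t))) D (H (Suc t))) g"
    using smooth[OF H_in] by blast
  from choice[OF this] obtain gk where
    gk: "\<And>t. smooth_bound ?S B (\<lambda>D. code_loss lam I (\<phi> (y (Suc t))) D (H (Suc t))) (gk t)" by blast
  have loss_abs: "\<bar>loss lam I Ccode (\<phi> s) x\<bar> \<le> B"
    and loss_diff: "x' \<in> ?S \<Longrightarrow> \<bar>loss lam I Ccode (\<phi> s) x - loss lam I Ccode (\<phi> s) x'\<bar> \<le> B * norm (x - x')"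
    and loss_le: "V \<in> Ccode \<Longrightarrow> loss lam I Ccode (\<phi> s) x \<le> code_loss lam I (\<phi> s) x V"
    if "x \<in> ?S" for x x' s V
    unfolding loss_def
    using INF_smooth_bound[where A = Ccode and k = "code_loss lam I (\<phi> s)", OF _ code_ne convex_cball that] smooth
    by blast+
  obtain R where R1: "1 \<le> R" and R: "\<And>i U V. U \<in> C i \<Longrightarrow> V \<in> C i \<Longrightarrow> norm (U - V) \<le> R"
  proof -
    have bd: "bounded (\<Union>i. C i)" using C(1) by (intro bounded_UN) (auto intro: compact_imp_bounded)
    then obtain r where r: "\<And>U. U \<in> (\<Union>i. C i) \<Longrightarrow> norm U \<le> r" by (auto simp: bounded_iff)
    show thesis
    proof (rule that[of "max 1 (2 * r)"])
      fix i U V assume "U \<in> C i" "V \<in> C i"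
      then have "norm U \<le> r" "norm V \<le> r" using r by auto
      then show "norm (U - V) \<le> max 1 (2 * r)" using norm_triangle_ineq4[of U V] by linarith
    qed simp
  qed
  \<comment> \<open>The comparison step of length \<open>a * w (Suc t)\<close> is then at most 1,
    and its displacement stays within the search radius \<open>c * w (Suc t)\<close>.\<close>
  define a where "a = min 1 (c / R)"
  have a: "0 < a" "a \<le> 1" "a * R \<le> c" using R1 c by (auto simp: a_def min_def field_simps)
  \<comment> \<open>The error of \<open>block_coordinate_descent\<close> with both the step length
    and the radius proportional to the weight, after factoring out its square.\<close>
  define b where "b = real CARD('n) * (a * B * real CARD('n) * c * R + B * (a * R)\<^sup>2)"
  interpret surrogate_descent "\<lambda>t. w (Suc t)" ?S ?K B "real CARD('n) * c" a b
    "\<lambda>s. loss lam I Ccode (\<phi> s)" "pmf \<pi>" "\<lambda>t. y (Suc t)"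
    "\<lambda>t D. code_loss lam I (\<phi> (y (Suc t))) D (H (Suc t))" gk F e D
  proof
    fix t :: nat and s :: 's and x x' V :: "('n, 'k, 'r) mat_tuple" and g
    show "0 < w (Suc t) \<and> w (Suc t) \<le> 1" using wS by simp
    show "w (Suc (Suc t)) \<le> w (Suc t)" by (rule w(2)) simp
    show "\<not> summable (\<lambda>t. w (Suc t))" "summable (\<lambda>t. (w (Suc t))\<^sup>2)" by fact+
    show "convex ?S" by (rule convex_cball)
    show "compact ?K" by (rule K_compact)
    show "D t \<in> ?K" by (rule D_in)
    show "cball x 1 \<subseteq> ?S" if "x \<in> ?K"
    proof
      fix z assume "z \<in> cball x 1"
      then have "norm (z - x) \<le> 1" by (simp add: dist_norm norm_minus_commute)
      then show "z \<in> ?S" using \<rho>[OF that] norm_triangle_sub[of z x] by simp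
    qed
    show "\<bar>loss lam I Ccode (\<phi> s) x\<bar> \<le> B" if "x \<in> ?S" using that by (rule loss_abs)
    show "\<bar>loss lam I Ccode (\<phi> s) x - loss lam I Ccode (\<phi> s) x'\<bar> \<le> B * norm (x - x')"
      if "x \<in> ?S" "x' \<in> ?S" using that by (rule loss_diff)
    show "0 \<le> pmf \<pi> s \<and> pmf \<pi> s \<le> 1" by (simp add: pmf_le_1)
    show "smooth_bound ?S B (\<lambda>D. code_loss lam I (\<phi> (y (Suc t))) D (H (Suc t))) (gk t)" by (rule gk)
    show "loss lam I Ccode (\<phi> (y (Suc t))) x \<le> code_loss lam I (\<phi> (y (Suc t))) x (H (Suc t))" if "x \<in> ?S"
      using that H_in by (rule loss_le)
    show "code_loss lam I (\<phi> (y (Suc t))) (D t) (H (Suc t)) = loss lam I Ccode (\<phi> (y (Suc t))) (D t)"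
    proof (rule antisym)
      show "code_loss lam I (\<phi> (y (Suc t))) (D t) (H (Suc t)) \<le> loss lam I Ccode (\<phi> (y (Suc t))) (D t)"
        unfolding loss_def by (rule cINF_greatest[OF code_ne H_min])
      show "loss lam I Ccode (\<phi> (y (Suc t))) (D t) \<le> code_loss lam I (\<phi> (y (Suc t))) (D t) (H (Suc t))"
        using D_S H_in by (rule loss_le)
    qed
    show "F 0 = (\<lambda>_. 0)" "e 0 = (\<lambda>_. 0)" by (simp_all add: F_def e_def fun_eq_iff)
    show "F (Suc t) = (\<lambda>x. (1 - w (Suc t)) * F t x + w (Suc t) * code_loss lam I (\<phi> (y (Suc t))) x (H (Suc t)))"
      by (simp add: F_def fun_eq_iff)
    show "e (Suc t) = (\<lambda>x. (1 - w (Suc t)) * e t x + w (Suc t) * loss lam I Ccode (\<phi> (y (Suc t))) x)"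
      by (simp add: e_def fun_eq_iff)
    show "norm (D (Suc t) - D t) \<le> real CARD('n) * c * w (Suc t)"
    proof -
      have "norm (D (Suc t) - D t) \<le> (\<Sum>i\<in>UNIV. norm ((D (Suc t) - D t) $ i))" by (rule norm_vec_le_sum)
      also have "\<dots> \<le> (\<Sum>i\<in>(UNIV::'n set). c * w (Suc t))" using D_step by (intro sum_mono) simp
      finally show ?thesis by simp
    qed
    show "0 < a" by (rule a)
    show "summable (\<lambda>t. w (Suc t) * \<bar>occupation_error (\<lambda>t. w (Suc t)) (pmf \<pi>) (\<lambda>t. y (Suc t)) t s\<bar>)"
      by (rule q)
    show "F (Suc t) (D (Suc t)) \<le> F (Suc t) (D t) + a * w (Suc t) * (g (D t) \<bullet> (V - D t)) + b * (w (Suc t))\<^sup>2"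
      if g: "smooth_bound ?S B (F (Suc t)) g" and V: "V \<in> ?K"
    proof -
      have "F (Suc t) (D (Suc t)) \<le> F (Suc t) (D t) + (a * w (Suc t)) * (g (D t) \<bullet> (V - D t))
        + real CARD('n) * ((a * w (Suc t)) * B * real CARD('n) * (c * w (Suc t)) * R + B * ((a * w (Suc t)) * R)\<^sup>2)"
      proof (rule block_coordinate_descent[OF g convex_cball, where C = C])
        show "{D. \<forall>i. D $ i \<in> C i} \<subseteq> ?S" using K_S by (simp add: dict_set_def)
        show "V $ i \<in> C i" for i using V by (simp add: dict_set_def)
        show "0 \<le> a * w (Suc t)" "a * w (Suc t) \<le> 1" using a wS[of t] by (auto intro: mult_le_one)
        show "a * w (Suc t) * R \<le> c * w (Suc t)"
          using mult_right_mono[OF a(3), of "w (Suc t)"] wS[of t] by (simp add: mult_ac)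
        show "F (Suc t) (\<chi> j. if j < i then D (Suc t) $ j else if j = i then D (Suc t) $ i else D t $ j)
            \<le> F (Suc t) (\<chi> j. if j < i then D (Suc t) $ j else if j = i then U else D t $ j)"
          if "U \<in> C i" "norm (U - D t $ i) \<le> c * w (Suc t)" for i U
          unfolding F_def using block[of t i] that by (meson not_le)
      qed (use C R D_C D_step in auto)
      also have "real CARD('n) * ((a * w (Suc t)) * B * real CARD('n) * (c * w (Suc t)) * R + B * ((a * w (Suc t)) * R)\<^sup>2)
        = b * (w (Suc t))\<^sup>2" by (simp add: b_def power2_eq_square algebra_simps)
      finally show ?thesis .
    qed
  qed
  have f_eq: "f = expf"
  proof
    fix D
    show "f D = expf D"
      unfolding f_def expf_def exp_loss_def
      by (subst integral_measure_pmf_real[of UNIV]) (auto simp: mult.commute)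
  qed
  have "(\<lambda>t. block_setdist (D t) {E. stationary_point expf ?K E}) \<longlonglongrightarrow> 0" if C1: "C1_Lipschitz_gradient_on expf ?K"
  proof (rule order_tendstoI)
    fix u :: ereal assume "u < 0"
    moreover have "0 \<le> block_setdist (D t) {E. stationary_point expf ?K E}" for t
      unfolding block_setdist_def by (intro INF_greatest) (simp add: block_dist_def sum_nonneg)
    ultimately show "\<forall>\<^sub>F t in sequentially. u < block_setdist (D t) {E. stationary_point expf ?K E}"
      by (simp add: less_le_trans)
  next
    fix u :: ereal assume u: "0 < u"
    show "\<forall>\<^sub>F t in sequentially. block_setdist (D t) {E. stationary_point expf ?K E} < u"
    \<comment> \<open>Otherwise some subsequence stays at distance at least \<open>u\<close>; by
      compactness it has a limit point, which is stationary and thus contradicts that distance. In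
      particular the set of stationary points is nonempty.\<close>
    proof (rule ccontr)
      assume "\<not> ?thesis"
      from not_eventually_sequentiallyD[OF this] obtain \<sigma> :: "nat \<Rightarrow> nat" where \<sigma>: "strict_mono \<sigma>"
        and far: "\<And>n. u \<le> block_setdist (D (\<sigma> n)) {E. stationary_point expf ?K E}"
        by (auto simp: not_less)
      obtain x \<tau> where x: "x \<in> ?K" and \<tau>: "strict_mono \<tau>" and lim: "((\<lambda>n. D (\<sigma> n)) \<circ> \<tau>) \<longlonglongrightarrow> x"
        using K_compact[unfolded compact_def, THEN spec, of "\<lambda>n. D (\<sigma> n)"] D_in by blast
      obtain G where G: "GDERIV expf x :> G" using C1 x by (auto simp: C1_Lipschitz_gradient_on_def)
      have lim': "(\<lambda>n. D ((\<sigma> \<circ> \<tau>) n)) \<longlonglongrightarrow> x" using lim by (simp add: o_def)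
      have "0 \<le> G \<bullet> (V - x)" if "V \<in> ?K" for V
        by (rule limit_point_stationary[OF strict_mono_o[OF \<sigma> \<tau>] lim' _ that]) (simp add: f_eq G)
      then have stat: "stationary_point expf ?K x" using x G by (auto simp: stationary_point_def)
      have le: "u \<le> ereal (block_dist (D ((\<sigma> \<circ> \<tau>) n)) x)" for n
        using far[of "\<tau> n"] stat unfolding block_setdist_def by (auto intro: order_trans INF_lower)
      have "(\<lambda>n. ereal (block_dist (D ((\<sigma> \<circ> \<tau>) n)) x)) \<longlonglongrightarrow> ereal (block_dist x x)"
        unfolding block_dist_def by (intro tendsto_intros lim')
      from LIMSEQ_le_const[OF this] le have "u \<le> ereal (block_dist x x)" by blast
      then show False using u by (simp add: block_dist_def flip: zero_ereal_def)
    qed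
  qed
  moreover have "(\<lambda>t. e t (D t) - F t (D t)) \<longlonglongrightarrow> 0"
    using tendsto_minus[OF emp_sur_tendsto] by simp
  moreover have "\<bar>F t (D t)\<bar> \<le> B \<and> \<bar>e t (D t)\<bar> \<le> B" for t
    using smooth_boundD(1)[OF F_smooth D_S] e_bound[OF D_S] by blast
  ultimately show ?thesis using sur_convergent exp_sur_tendsto unfolding f_eq by blast
qed

section \<open>Measurability of the losses along the iterates\<close>

lemma code_loss_measurable:
  fixes E :: "'w \<Rightarrow> ('n::finite, 'k::finite, 'r::finite) mat_tuple" and H :: "'w \<Rightarrow> real^'b::finite^'r"
  assumes "E \<in> borel_measurable M" "H \<in> borel_measurable M"
  shows "(\<lambda>x. code_loss lam I X (E x) (H x)) \<in> borel_measurable M"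
proof (rule borel_measurable_continuous_Pair[OF assms])
  have "continuous_on UNIV (\<lambda>z::('n, 'k, 'r) mat_tuple \<times> (real^'b^'r). Out I (fst z) $ \<kappa> $ r)" for \<kappa> r
  proof (cases "\<forall>i. \<kappa> i \<in> I i")
    case True
    then show ?thesis by (simp add: Out_def) (intro continuous_intros)
  next
    case False
    then have "Out I D $ \<kappa> $ r = 0" for D :: "('n, 'k, 'r) mat_tuple"
      unfolding Out_def vec_lambda_beta by (rule if_not_P)
    then show ?thesis by simp
  qed
  then have "continuous_on UNIV
      (\<lambda>z::('n, 'k, 'r) mat_tuple \<times> (real^'b^'r). \<chi> \<kappa> r. Out I (fst z) $ \<kappa> $ r)"
    by (intro continuous_on_vec_lambda)
  then have "continuous_on UNIV (\<lambda>z::('n, 'k, 'r) mat_tuple \<times> (real^'b^'r). Out I (fst z))"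
    by simp
  then show "continuous_on UNIV (\<lambda>z::('n, 'k, 'r) mat_tuple \<times> (real^'b^'r). code_loss lam I X (fst z) (snd z))"
    unfolding code_loss_def l1_norm_def mode_product_def by (intro continuous_intros)
qed

text \<open>The infimum ranges over a possibly uncountable set of codes, so measurability is
  obtained from continuity: the loss is Lipschitz on every ball.\<close>

lemma loss_measurable:
  fixes E :: "'w \<Rightarrow> ('n::finite, 'k::finite, 'r::finite) mat_tuple" and Ccode :: "(real^'b::finite^'r) set"
  assumes E: "E \<in> borel_measurable M" and Ccode: "bounded Ccode" "Ccode \<noteq> {}"
  shows "(\<lambda>x. loss lam I Ccode X (E x)) \<in> borel_measurable M"
proof -
  have "continuous_on (cball 0 \<rho>) (loss lam I Ccode X :: ('n, 'k, 'r) mat_tuple \<Rightarrow> real)" for \<rho>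
  proof -
    obtain B where B: "0 \<le> B" "\<And>V. V \<in> Ccode \<Longrightarrow>
        \<exists>g. smooth_bound (cball 0 \<rho>) B (\<lambda>D :: ('n, 'k, 'r) mat_tuple. code_loss lam I X D V) g"
      using uniformly_smooth_code_loss[of "cball 0 \<rho> :: ('n, 'k, 'r) mat_tuple set" "{X}" Ccode lam I] Ccode(1)
      by (auto simp: uniformly_smooth_def)
    have "B-lipschitz_on (cball 0 \<rho>) (loss lam I Ccode X :: ('n, 'k, 'r) mat_tuple \<Rightarrow> real)"
    proof (rule lipschitz_onI[OF _ B(1)])
      fix x x' :: "('n, 'k, 'r) mat_tuple" assume "x \<in> cball 0 \<rho>" "x' \<in> cball 0 \<rho>"
      then show "dist (loss lam I Ccode X x) (loss lam I Ccode X x') \<le> B * dist x x'"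
        unfolding loss_def dist_norm real_norm_def
        by (intro INF_smooth_bound(2)[where k = "code_loss lam I X", OF B(2) Ccode(2) convex_cball])
    qed
    then show ?thesis by (rule lipschitz_on_continuous_on)
  qed
  then have "isCont (loss lam I Ccode X :: ('n, 'k, 'r) mat_tuple \<Rightarrow> real) D" for D
    by (rule continuous_on_interior[where S = "cball 0 (norm D + 1)"]) simp
  then have "continuous_on UNIV (loss lam I Ccode X :: ('n, 'k, 'r) mat_tuple \<Rightarrow> real)"
    by (simp add: continuous_at_imp_continuous_on)
  then show ?thesis by (rule borel_measurable_continuous_on[OF _ E])
qed

lemma sur_loss_measurable:
  fixes Y :: "nat \<Rightarrow> 'w \<Rightarrow> 's::finite" and E :: "'w \<Rightarrow> ('n::finite, 'k::finite, 'r::finite) mat_tuple"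
    and \<phi> :: "'s \<Rightarrow> ('n, 'k, 'b::finite) tensor"
  assumes Y: "\<And>t. t \<ge> 1 \<Longrightarrow> Y t \<in> measurable M (count_space UNIV)"
    and H: "\<And>t. t \<ge> 1 \<Longrightarrow> H t \<in> borel_measurable M" and E: "E \<in> borel_measurable M"
  shows "(\<lambda>x. sur_loss lam I w (\<lambda>t. \<phi> (Y t x)) (\<lambda>t. H t x) t (E x)) \<in> borel_measurable M"
proof (induction t)
  case (Suc t)
  have "(\<lambda>x. code_loss lam I (\<phi> (Y (Suc t) x)) (E x) (H (Suc t) x)) \<in> borel_measurable M"
    \<comment> \<open>The data take finitely many values, so measurability is checked for each fixed
      state.\<close>
    by (rule measurable_compose_countable[where f = "\<lambda>s x. code_loss lam I (\<phi> s) (E x) (H (Suc t) x)"])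
      (simp_all add: code_loss_measurable E H Y)
  with Suc show ?case by simp
qed simp

lemma emp_loss_measurable:
  fixes Y :: "nat \<Rightarrow> 'w \<Rightarrow> 's::finite" and E :: "'w \<Rightarrow> ('n::finite, 'k::finite, 'r::finite) mat_tuple"
    and \<phi> :: "'s \<Rightarrow> ('n, 'k, 'b::finite) tensor"
  assumes Y: "\<And>t. t \<ge> 1 \<Longrightarrow> Y t \<in> measurable M (count_space UNIV)"
    and E: "E \<in> borel_measurable M" and Ccode: "bounded Ccode" "Ccode \<noteq> {}"
  shows "(\<lambda>x. emp_loss lam I Ccode w (\<lambda>t. \<phi> (Y t x)) t (E x)) \<in> borel_measurable M"
proof (induction t)
  case (Suc t)
  have "(\<lambda>x. loss lam I Ccode (\<phi> (Y (Suc t) x)) (E x)) \<in> borel_measurable M"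
    by (rule measurable_compose_countable[where f = "\<lambda>s x. loss lam I Ccode (\<phi> s) (E x)"])
      (simp_all add: loss_measurable E Y Ccode)
  with Suc show ?case by simp
qed simp

section \<open>Divergence of the weights and the final assembly\<close>

lemma weights_not_summable:
  fixes w :: "nat \<Rightarrow> real"
  assumes "filterlim (\<lambda>N. \<Sum>t=1..N. w t) at_top sequentially"
  shows "\<not> summable (\<lambda>t. w (Suc t))"
proof
  assume "summable (\<lambda>t. w (Suc t))"
  then have "convergent (\<lambda>N. \<Sum>t<N. w (Suc t))" by (simp only: summable_iff_convergent)
  then obtain L where "(\<lambda>N. \<Sum>t=1..N. w t) \<longlonglongrightarrow> L"
    by (auto simp: convergent_def sum.atLeast1_atMost_eq)
  then show False
    using not_tendsto_and_filterlim_at_infinity[OF sequentially_bot _ filterlim_at_top_imp_at_infinity[OF assms]]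
    by blast
qed

theorem theorem4p1:
  fixes M :: "'w measure"
    and P :: "real^'s::finite^'s"
    and \<pi> :: "'s pmf"
    and Y :: "nat \<Rightarrow> 'w \<Rightarrow> 's"
    and \<phi> :: "'s \<Rightarrow> ('n::{finite,linorder}, 'k::finite, 'b::finite) tensor"
    and I :: "'n \<Rightarrow> 'k set"
    and C :: "'n \<Rightarrow> (real^'r::finite^'k) set"
    and Ccode :: "(real^'b^'r) set"
    and lam c :: real
    and w :: "nat \<Rightarrow> real"
    and H :: "nat \<Rightarrow> 'w \<Rightarrow> real^'b^'r"
    and D :: "nat \<Rightarrow> 'w \<Rightarrow> ('n, 'k, 'r) mat_tuple"
  defines "X \<equiv> \<lambda>x t. \<phi> (Y t x)"
    and "f \<equiv> exp_loss lam I Ccode \<pi> \<phi>"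
  assumes setting: "prob_space M" "\<And>i. I i \<noteq> {}" "lam \<ge> 0" "c > 0"
    and A1: "markov_chain M P Y" "irreducible_matrix P" "aperiodic_matrix P"
      "\<forall>\<rho>. stationary_distribution P \<rho> \<longleftrightarrow> \<rho> = \<pi>"
      "range \<phi> \<subseteq> tensors_on I" "bounded (range \<phi>)"
    and A2: "\<And>i. C i \<subseteq> matrices_on (I i)" "\<And>i. compact (C i)" "\<And>i. convex (C i)"
      "\<And>i. \<exists>U\<in>C i. \<exists>V\<in>C i. U \<noteq> V"
      "compact Ccode" "convex Ccode"
    and A3: "\<And>t. t \<ge> 1 \<Longrightarrow> 0 < w t \<and> w t \<le> 1" "\<And>t. t \<ge> 1 \<Longrightarrow> w (Suc t) \<le> w t"
      "filterlim (\<lambda>N. \<Sum>t=1..N. w t) at_top sequentially"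
      "summable (\<lambda>t. (w (Suc t))\<^sup>2 * sqrt (real (Suc t)))"
      "\<forall>\<^sub>F t in sequentially. inverse (w (Suc t)) - inverse (w t) \<le> 1"
    and random_variables: "\<And>t. D t \<in> borel_measurable M" "\<And>t. t \<ge> 1 \<Longrightarrow> H t \<in> borel_measurable M"
    and algorithm: "\<And>x. x \<in> space M \<Longrightarrow>
      ocpdl_output lam I C Ccode w c (X x) (\<lambda>t. H t x) (\<lambda>t. D t x)"
  shows "(\<exists>L. (\<lambda>t. \<integral>x. emp_loss lam I Ccode w (X x) t (D t x) \<partial>M) \<longlonglongrightarrow> L \<and>
              (\<lambda>t. \<integral>x. sur_loss lam I w (X x) (\<lambda>t. H t x) t (D t x) \<partial>M) \<longlonglongrightarrow> L) \<and>
         (AE x in M.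
            (\<lambda>t. emp_loss lam I Ccode w (X x) t (D t x)
                 - sur_loss lam I w (X x) (\<lambda>t. H t x) t (D t x)) \<longlonglongrightarrow> 0 \<and>
            (\<lambda>t. f (D t x) - sur_loss lam I w (X x) (\<lambda>t. H t x) t (D t x)) \<longlonglongrightarrow> 0) \<and>
         (C1_Lipschitz_gradient_on f (dict_set C) \<longrightarrow>
            (AE x in M.
               (\<lambda>t. block_setdist (D t x) {E. stationary_point f (dict_set C) E}) \<longlonglongrightarrow> 0))"
proof -
  interpret prob_space M by (rule setting(1))
  define F where "F t x = sur_loss lam I w (X x) (\<lambda>t. H t x) t (D t x)" for t x
  define e where "e t x = emp_loss lam I Ccode w (X x) t (D t x)" for t x
  let ?stationary = "\<lambda>x. (\<lambda>t. block_setdist (D t x) {E. stationary_point f (dict_set C) E}) \<longlonglongrightarrow> 0"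
  have \<pi>: "stationary_distribution P \<pi>" using A1(4) by blast
  have Ccode: "bounded Ccode" "Ccode \<noteq> {}"
  proof -
    show "bounded Ccode" using A2(5) by (rule compact_imp_bounded)
    obtain x where "x \<in> space M" using not_empty by blast
    from algorithm[OF this] show "Ccode \<noteq> {}" by (auto simp: ocpdl_output_def is_arg_min_def)
  qed
  obtain \<rho> where \<rho>: "\<And>D. D \<in> dict_set C \<Longrightarrow> norm D + 1 \<le> \<rho>"
  proof -
    obtain r where "\<And>D. D \<in> dict_set C \<Longrightarrow> norm D \<le> r"
      using compact_imp_bounded[OF compact_dict_set[where C = C, OF A2(2)]] by (auto simp: bounded_iff)
    then show thesis by (intro that[of "r + 1"]) simp
  qed
  \<comment> \<open>One deterministic constant for all states and codes; it later serves as the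
    dominating function.\<close>
  obtain B where B: "\<And>s V. V \<in> Ccode \<Longrightarrow>
      \<exists>g. smooth_bound (cball 0 \<rho>) B (\<lambda>D :: ('n, 'k, 'r) mat_tuple. code_loss lam I (\<phi> s) D V) g"
    using uniformly_smooth_code_loss[of "cball 0 \<rho> :: ('n, 'k, 'r) mat_tuple set" "range \<phi>" Ccode lam I] A1(6) Ccode(1)
    by (auto simp: uniformly_smooth_def)
  have w2: "summable (\<lambda>t. (w (Suc t))\<^sup>2)"
  proof (rule summable_comparison_test'[OF A3(4)])
    show "norm ((w (Suc t))\<^sup>2) \<le> (w (Suc t))\<^sup>2 * sqrt (real (Suc t))" for t
      using mult_left_mono[of 1 "sqrt (real (Suc t))" "(w (Suc t))\<^sup>2"] by simp
  qed
  have occupation: "AE x in M. \<forall>s. summable (\<lambda>t. w (Suc t) *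
      \<bar>occupation_error (\<lambda>t. w (Suc t)) (pmf \<pi>) (\<lambda>t. Y (Suc t) x) t s\<bar>)"
    by (rule markov_chain_occupation_error_summable[where w = w, OF setting(1) A1(1,2) \<pi> _ _ A3(4,5)])
      (use A3(1,2) in auto)
  have path: "AE x in M. convergent (\<lambda>t. F t x) \<and> (\<lambda>t. e t x - F t x) \<longlonglongrightarrow> 0 \<and> (\<lambda>t. f (D t x) - F t x) \<longlonglongrightarrow> 0
      \<and> (\<forall>t. \<bar>F t x\<bar> \<le> B \<and> \<bar>e t x\<bar> \<le> B)
      \<and> (C1_Lipschitz_gradient_on f (dict_set C) \<longrightarrow> ?stationary x)"
    using occupation AE_space
  proof eventually_elim
    case (elim x)
    show ?case unfolding F_def e_def f_def X_def
    proof (rule ocpdl_pathwise[where \<rho> = \<rho> and B = B])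
      show "ocpdl_output lam I C Ccode w c (\<lambda>t. \<phi> (Y t x)) (\<lambda>t. H t x) (\<lambda>t. D t x)"
        using algorithm[OF elim(2)] by (simp add: X_def)
    qed (use setting(4) A2(2,3) A3(1,2) weights_not_summable[OF A3(3)] w2 \<rho> B elim(1) in blast)+
  qed
  have Y: "Y t \<in> measurable M (count_space UNIV)" if "t \<ge> 1" for t
    using markov_chain_measurable_state[OF A1(1) that] .
  have F_meas [measurable]: "F t \<in> borel_measurable M" for t
    unfolding F_def[abs_def] X_def by (intro sur_loss_measurable Y random_variables)
  have e_meas [measurable]: "e t \<in> borel_measurable M" for t
    unfolding e_def[abs_def] X_def by (intro emp_loss_measurable Y random_variables Ccode)
  have lim_meas: "(\<lambda>x. lim (\<lambda>t. F t x)) \<in> borel_measurable M"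
    by (rule borel_measurable_lim_metric) (rule F_meas)
  \<comment> \<open>The common limit of the expectations is the mean of the almost sure limit of the
    surrogate values, which the empirical losses share.\<close>
  have "(\<lambda>t. \<integral>x. F t x \<partial>M) \<longlonglongrightarrow> (\<integral>x. lim (\<lambda>t. F t x) \<partial>M)"
  proof (rule integral_dominated_convergence[where w = "\<lambda>_. B"])
    show "AE x in M. (\<lambda>t. F t x) \<longlonglongrightarrow> lim (\<lambda>t. F t x)"
      using path by eventually_elim (simp add: convergent_LIMSEQ_iff)
    show "AE x in M. norm (F t x) \<le> B" for t
      using path by eventually_elim simp
  qed (use lim_meas in auto)
  moreover have "(\<lambda>t. \<integral>x. e t x \<partial>M) \<longlonglongrightarrow> (\<integral>x. lim (\<lambda>t. F t x) \<partial>M)"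
  proof (rule integral_dominated_convergence[where w = "\<lambda>_. B"])
    show "AE x in M. (\<lambda>t. e t x) \<longlonglongrightarrow> lim (\<lambda>t. F t x)"
      using path
    proof eventually_elim
      case (elim x)
      then have "(\<lambda>t. (e t x - F t x) + F t x) \<longlonglongrightarrow> 0 + lim (\<lambda>t. F t x)"
        by (intro tendsto_add) (simp_all add: convergent_LIMSEQ_iff)
      then show ?case by simp
    qed
    show "AE x in M. norm (e t x) \<le> B" for t
      using path by eventually_elim simp
  qed (use lim_meas in auto)
  moreover have "AE x in M. (\<lambda>t. e t x - F t x) \<longlonglongrightarrow> 0 \<and> (\<lambda>t. f (D t x) - F t x) \<longlonglongrightarrow> 0"
    using path by eventually_elim simp
  moreover have "AE x in M. ?stationary x" if "C1_Lipschitz_gradient_on f (dict_set C)"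
    using path by eventually_elim (simp add: that)
  ultimately show ?thesis unfolding F_def e_def by blast
qed

end
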